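(* Let $\Bbbk$ be a field of characteristic $0$ and let $\mathcal H$ be a (not necessarily commutative) Hopf algebroid over a commutative $\Bbbk$-algebra $A$ such that $s_l=t_r=t$ and $s_r=t_l=s$. Then the algebra $\mathfrak B(\mathcal H)=\Bbbk\,\mathfrak{Brt}(\mathcal H,A)$, generated by the set of local biretractions of $\mathcal H$ with the convolution product, is a quantum inverse semigroup.
   Context: Left bialgebroid over $A$: a quintuple $(\mathcal H,s_l,t_l,\Delta_l,\varepsilon_l)$ where $\mathcal H$ is a unital $\Bbbk$-algebra and: (LB1) $s_l:A\to\mathcal H$ is an algebra morphism and $t_l:A\to\mathcal H$ an algebra antimorphism with $s_l(a)t_l(b)=t_l(b)s_l(a)$, making $\mathcal H$ an $A$-bimodule by $a\triangleright h\triangleleft b=s_l(a)t_l(b)h$; (LB2) $(\mathcal H,\Delta_l,\varepsilon_l)$ is an $A$-coring for this bimodule structure; (LB3) $\Delta_l(\mathcal H)\subseteq\{\sum h_i\otimes k_i\in\mathcal H\otimes_A\mathcal H:\sum h_it_l(a)\otimes k_i=\sum h_i\otimes k_is_l(a)\ \forall a\in A\}$ and the corestriction of $\Delta_l$ to this set is an algebra morphism; (LB4) $\varepsilon_l(hk)=\varepsilon_l(h\,s_l(\varepsilon_l(k)))=\varepsilon_l(h\,t_l(\varepsilon_l(k)))$. Right bialgebroid over $A$: a quintuple $(\mathcal H,s_r,t_r,\Delta_r,\varepsilon_r)$ where $\mathcal H$ is a unital $\Bbbk$-algebra and: (RB1) $s_r$ is an algebra morphism and $t_r$ an algebra antimorphism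 $A\to\mathcal H$ with commuting images, making $\mathcal H$ an $A$-bimodule by $a\blacktriangleright h\blacktriangleleft b=h\,t_r(a)s_r(b)$; (RB2) $(\mathcal H,\Delta_r,\varepsilon_r)$ is an $A$-coring for this bimodule structure; (RB3) $\Delta_r(\mathcal H)\subseteq\{\sum h_i\otimes k_i\in\mathcal H\otimes_A\mathcal H:\sum s_r(a)h_i\otimes k_i=\sum h_i\otimes t_r(a)k_i\ \forall a\in A\}$ and the corestriction of $\Delta_r$ to this set is an algebra morphism; (RB4) $\varepsilon_r(hk)=\varepsilon_r(s_r(\varepsilon_r(h))k)=\varepsilon_r(t_r(\varepsilon_r(h))k)$. Hopf algebroid over $A$ (both base algebras equal to the commutative algebra $A$): an algebra $\mathcal H$ with a left bialgebroid structure and a right bialgebroid structure over $A$ and a $\Bbbk$-linear map $S:\mathcal H\to\mathcal H$ such that: (HA2) $s_l\varepsilon_lt_r=t_r$, $t_l\varepsilon_ls_r=s_r$, $s_r\varepsilon_rt_l=t_l$, $t_r\varepsilon_rs_l=s_l$; (HA3) $(\Delta_l\otimes_A\mathcal H)\Delta_r=(\mathcal H\otimes_A\Delta_r)\Delta_l$ and $(\Delta_r\otimes_A\mathcal H)\Delta_l=(\mathcal H\otimes_A\Delta_l)\Delta_r$ (each tensor product over $A$ being formed with the left or right bimodule structure as dictated by the corresponding comultiplication); (HA4) $S(t_l(a)\,h\,t_r(b))=s_r(b)S(h)s_l(a)$ for all $a,b\in A$, $h\in\mathcal H$; (HA5) writing $\Delta_l(h)=h_{(1)}\otimes h_{(2)}$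 and $\Delta_r(h)=h^{(1)}\otimes h^{(2)}$, $S(h_{(1)})h_{(2)}=s_r(\varepsilon_r(h))$ and $h^{(1)}S(h^{(2)})=s_l(\varepsilon_l(h))$. Local biretraction of $\mathcal H$ (when $s_l=t_r=t$ and $s_r=t_l=s$): a $\Bbbk$-linear and multiplicative (not necessarily unital) map $\alpha:\mathcal H\to A$ such that (BRT1) $\alpha(s(a))=a\,\alpha(1_{\mathcal H})$ for every $a\in A$; (BRT2) there exists $e^\alpha\in A$ such that $\alpha(t(e^\alpha))=\alpha(1_{\mathcal H})$ and $\alpha\circ t|_{Ae^\alpha}:Ae^\alpha\to A\,\alpha(1_{\mathcal H})$ is a bijection. The set of local biretractions is $\mathfrak{Brt}(\mathcal H,A)$. It is a semigroup under the convolution product $(\alpha\ast\beta)(h)=\beta(t(\alpha(h_{(1)})))\,\beta(h_{(2)})$. The algebra $\mathfrak B(\mathcal H)$ is the free $\Bbbk$-vector space with basis $\mathfrak{Brt}(\mathcal H,A)$, with the convolution product extended bilinearly. Quantum inverse semigroup (QISG): a triple $(Q,\underline\Delta,\mathcal S)$ in which (QISG1) $Q$ is a (not necessarily unital) associative $\Bbbk$-algebra; (QISG2) $\underline\Delta:Q\to Q\otimes_\Bbbk Q$ is $\Bbbk$-linear, multiplicative and coassociative (write $\underline\Delta(q)=q_{(1)}\otimes q_{(2)}$); (QISG3) $\mathcal S:Q\to Q$ is a $\Bbbk$-linear map (the pseudo-antipode) such that (i) $\mathcal S(pq)=\mathcal S(q)\mathcal S(p)$ for all $p,q\in Q$, and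 (ii) $q_{(1)}\mathcal S(q_{(2)})q_{(3)}=q$ and $\mathcal S(q_{(1)})q_{(2)}\mathcal S(q_{(3)})=\mathcal S(q)$ for all $q\in Q$; (QISG4) for all $p,q\in Q$, $p_{(1)}\mathcal S(p_{(2)})\mathcal S(q_{(1)})q_{(2)}=\mathcal S(q_{(1)})q_{(2)}p_{(1)}\mathcal S(p_{(2)})$. *)

theory Defs
  imports Complex_Main "HOL-Library.Poly_Mapping"
begin

text \<open>
  Rings are taken in the sorts \<open>{ring, monoid_mult}\<close> (unital ring) and
  \<open>{comm_ring, comm_monoid_mult}\<close> (commutative unital ring) rather than \<open>ring_1\<close> and
  \<open>comm_ring_1\<close>, because the latter exclude the zero ring.
\<close>

section \<open>Tensor products\<close>

text \<open>
  An element of a tensor product is given by a formal sum \<open>x\<^sub>1 \<otimes> y\<^sub>1 + \<dots> + x\<^sub>n \<otimes> y\<^sub>n\<close>, represented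
  by the list of its summands, and equality in the tensor product is the congruence generated by
  the defining relations. So the tensor product is the quotient of the free commutative monoid on
  \<open>M \<times> N\<close>; it is a group because \<open>[(x, y), (- x, y)]\<close> is congruent to \<open>[(0, y)]\<close> and hence to \<open>[]\<close>.
  A map into a tensor product is given by a choice of representatives, and everything required of
  it below is invariant under the congruence.
\<close>

inductive fsum_eq :: "'e set \<Rightarrow> ('e list \<times> 'e list) set \<Rightarrow> 'e list \<Rightarrow> 'e list \<Rightarrow> bool"
  for E :: "'e set" and R :: "('e list \<times> 'e list) set"
where
  refl: "us \<in> lists E \<Longrightarrow> fsum_eq E R us us"
| rel: "(us, vs) \<in> R \<Longrightarrow> fsum_eq E R us vs"
| sym: "fsum_eq E R us vs \<Longrightarrow> fsum_eq E R vs us"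
| trans: "fsum_eq E R us vs \<Longrightarrow> fsum_eq E R vs ws \<Longrightarrow> fsum_eq E R us ws"
| add: "fsum_eq E R us us' \<Longrightarrow> fsum_eq E R vs vs' \<Longrightarrow> fsum_eq E R (us @ vs) (us' @ vs')"
| comm: "us \<in> lists E \<Longrightarrow> vs \<in> lists E \<Longrightarrow> fsum_eq E R (us @ vs) (vs @ us)"

text \<open>
  \<open>M \<otimes>\<^sub>R N\<close> for a right \<open>R\<close>-module \<open>M\<close> (action \<open>ract\<close>) and a left \<open>R\<close>-module \<open>N\<close> (action \<open>lact\<close>);
  all scalars of the type \<open>'r\<close> are used.
\<close>

definition tensor_rel ::
  "'m::ab_group_add set \<Rightarrow> 'n::ab_group_add set \<Rightarrow> ('m \<Rightarrow> 'r \<Rightarrow> 'm) \<Rightarrow> ('r \<Rightarrow> 'n \<Rightarrow> 'n)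
    \<Rightarrow> (('m \<times> 'n) list \<times> ('m \<times> 'n) list) set"
where
  "tensor_rel M N ract lact =
     {([(x + x', y)], [(x, y), (x', y)]) | x x' y. x \<in> M \<and> x' \<in> M \<and> y \<in> N}
   \<union> {([(x, y + y')], [(x, y), (x, y')]) | x y y'. x \<in> M \<and> y \<in> N \<and> y' \<in> N}
   \<union> {([(0, y)], []) | y. y \<in> N}
   \<union> {([(x, 0)], []) | x. x \<in> M}
   \<union> {([(ract x a, y)], [(x, lact a y)]) | x a y. x \<in> M \<and> y \<in> N}"

definition tensor_eq ::
  "'m::ab_group_add set \<Rightarrow> 'n::ab_group_add set \<Rightarrow> ('m \<Rightarrow> 'r \<Rightarrow> 'm) \<Rightarrow> ('r \<Rightarrow> 'n \<Rightarrow> 'n)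
    \<Rightarrow> ('m \<times> 'n) list \<Rightarrow> ('m \<times> 'n) list \<Rightarrow> bool"
where
  "tensor_eq M N ract lact = fsum_eq (M \<times> N) (tensor_rel M N ract lact)"

text \<open>
  \<open>M \<otimes>\<^sub>R N \<otimes>\<^sub>R' P\<close>, where \<open>ract, lact\<close> are the actions on \<open>M\<close> and \<open>N\<close> balanced in the first tensor
  sign and \<open>ract', lact'\<close> those on \<open>N\<close> and \<open>P\<close> balanced in the second one. Both bracketings of the
  iterated tensor product are identified with it.
\<close>

definition tensor3_rel ::
  "'m::ab_group_add set \<Rightarrow> 'n::ab_group_add set \<Rightarrow> 'p::ab_group_add set
    \<Rightarrow> ('m \<Rightarrow> 'r \<Rightarrow> 'm) \<Rightarrow> ('r \<Rightarrow> 'n \<Rightarrow> 'n) \<Rightarrow> ('n \<Rightarrow> 's \<Rightarrow> 'n) \<Rightarrow> ('s \<Rightarrow> 'p \<Rightarrow> 'p)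
    \<Rightarrow> (('m \<times> 'n \<times> 'p) list \<times> ('m \<times> 'n \<times> 'p) list) set"
where
  "tensor3_rel M N P ract lact ract' lact' =
     {([(x + x', y, z)], [(x, y, z), (x', y, z)]) | x x' y z.
        x \<in> M \<and> x' \<in> M \<and> y \<in> N \<and> z \<in> P}
   \<union> {([(x, y + y', z)], [(x, y, z), (x, y', z)]) | x y y' z.
        x \<in> M \<and> y \<in> N \<and> y' \<in> N \<and> z \<in> P}
   \<union> {([(x, y, z + z')], [(x, y, z), (x, y, z')]) | x y z z'.
        x \<in> M \<and> y \<in> N \<and> z \<in> P \<and> z' \<in> P}
   \<union> {([(0, y, z)], []) | y z. y \<in> N \<and> z \<in> P}
   \<union> {([(x, 0, z)], []) | x z. x \<in> M \<and> z \<in> P}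
   \<union> {([(x, y, 0)], []) | x y. x \<in> M \<and> y \<in> N}
   \<union> {([(ract x a, y, z)], [(x, lact a y, z)]) | x a y z. x \<in> M \<and> y \<in> N \<and> z \<in> P}
   \<union> {([(x, ract' y b, z)], [(x, y, lact' b z)]) | x y b z. x \<in> M \<and> y \<in> N \<and> z \<in> P}"

definition tensor3_eq ::
  "'m::ab_group_add set \<Rightarrow> 'n::ab_group_add set \<Rightarrow> 'p::ab_group_add set
    \<Rightarrow> ('m \<Rightarrow> 'r \<Rightarrow> 'm) \<Rightarrow> ('r \<Rightarrow> 'n \<Rightarrow> 'n) \<Rightarrow> ('n \<Rightarrow> 's \<Rightarrow> 'n) \<Rightarrow> ('s \<Rightarrow> 'p \<Rightarrow> 'p)
    \<Rightarrow> ('m \<times> 'n \<times> 'p) list \<Rightarrow> ('m \<times> 'n \<times> 'p) list \<Rightarrow> bool"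
where
  "tensor3_eq M N P ract lact ract' lact' =
     fsum_eq (M \<times> N \<times> P) (tensor3_rel M N P ract lact ract' lact')"

definition map_left :: "('m \<Rightarrow> ('x \<times> 'y) list) \<Rightarrow> ('m \<times> 'n) list \<Rightarrow> ('x \<times> 'y \<times> 'n) list"
  where "map_left D us = [(x1, x2, y). (x, y) \<leftarrow> us, (x1, x2) \<leftarrow> D x]"

definition map_right :: "('n \<Rightarrow> ('x \<times> 'y) list) \<Rightarrow> ('m \<times> 'n) list \<Rightarrow> ('m \<times> 'x \<times> 'y) list"
  where "map_right D us = [(x, y1, y2). (x, y) \<leftarrow> us, (y1, y2) \<leftarrow> D y]"

definition tensor_mult ::
  "('q \<Rightarrow> 'q \<Rightarrow> 'q) \<Rightarrow> ('q \<times> 'q) list \<Rightarrow> ('q \<times> 'q) list \<Rightarrow> ('q \<times> 'q) list"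
  where "tensor_mult m us vs = [(m x x', m y y'). (x, y) \<leftarrow> us, (x', y') \<leftarrow> vs]"


section \<open>Algebras, corings and bialgebroids\<close>

locale unital_algebra = vector_space scale
  for scale :: "'k::field \<Rightarrow> 'a::{ring, monoid_mult} \<Rightarrow> 'a" +
  assumes scale_mult_left: "scale c x * y = scale c (x * y)"
    and scale_mult_right: "x * scale c y = scale c (x * y)"

locale bimodule =
  fixes lact :: "'a::{ring, monoid_mult} \<Rightarrow> 'c::ab_group_add \<Rightarrow> 'c"
    and ract :: "'c \<Rightarrow> 'a \<Rightarrow> 'c"
  assumes lact_add_right: "lact a (x + y) = lact a x + lact a y"
    and lact_add_left: "lact (a + b) x = lact a x + lact b x"
    and lact_assoc: "lact (a * b) x = lact a (lact b x)"
    and lact_one: "lact 1 x = x"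
    and ract_add_left: "ract (x + y) a = ract x a + ract y a"
    and ract_add_right: "ract x (a + b) = ract x a + ract x b"
    and ract_assoc: "ract x (a * b) = ract (ract x a) b"
    and ract_one: "ract x 1 = x"
    and lact_ract: "ract (lact a x) b = lact a (ract x b)"

text \<open>
  \<open>D\<close> and \<open>e\<close> are \<open>A\<close>-bimodule maps \<open>C \<rightarrow> C \<otimes>\<^sub>A C\<close> and \<open>C \<rightarrow> A\<close>. For a bialgebroid over a
  \<open>k\<close>-algebra this includes \<open>k\<close>-linearity, since \<open>k\<close> acts through \<open>A\<close>.
\<close>

locale coring = bimodule lact ract
  for lact :: "'a::{ring, monoid_mult} \<Rightarrow> 'c::ab_group_add \<Rightarrow> 'c"
    and ract :: "'c \<Rightarrow> 'a \<Rightarrow> 'c" +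
  fixes D :: "'c \<Rightarrow> ('c \<times> 'c) list"
    and e :: "'c \<Rightarrow> 'a"
  assumes comult_add: "tensor_eq UNIV UNIV ract lact (D (x + y)) (D x @ D y)"
    and comult_lact: "tensor_eq UNIV UNIV ract lact (D (lact a x)) [(lact a u, v). (u, v) \<leftarrow> D x]"
    and comult_ract: "tensor_eq UNIV UNIV ract lact (D (ract x a)) [(u, ract v a). (u, v) \<leftarrow> D x]"
    and counit_add: "e (x + y) = e x + e y"
    and counit_lact: "e (lact a x) = a * e x"
    and counit_ract: "e (ract x a) = e x * a"
    and coassoc: "tensor3_eq UNIV UNIV UNIV ract lact ract lact
                    (map_left D (D x)) (map_right D (D x))"
    and counit_left: "(\<Sum>(u, v)\<leftarrow>D x. lact (e u) v) = x"
    and counit_right: "(\<Sum>(u, v)\<leftarrow>D x. ract u (e v)) = x"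

locale algebra_morphism =
  fixes scaleA :: "'k::field \<Rightarrow> 'a::{ring, monoid_mult} \<Rightarrow> 'a"
    and scaleH :: "'k \<Rightarrow> 'h::{ring, monoid_mult} \<Rightarrow> 'h"
    and f :: "'a \<Rightarrow> 'h"
  assumes linear: "Vector_Spaces.linear scaleA scaleH f"
    and mult: "f (a * b) = f a * f b"
    and one: "f 1 = 1"

locale algebra_antimorphism =
  fixes scaleA :: "'k::field \<Rightarrow> 'a::{ring, monoid_mult} \<Rightarrow> 'a"
    and scaleH :: "'k \<Rightarrow> 'h::{ring, monoid_mult} \<Rightarrow> 'h"
    and f :: "'a \<Rightarrow> 'h"
  assumes linear: "Vector_Spaces.linear scaleA scaleH f"
    and mult: "f (a * b) = f b * f a"
    and one: "f 1 = 1"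

definition left_lact :: "('a \<Rightarrow> 'h::times) \<Rightarrow> 'a \<Rightarrow> 'h \<Rightarrow> 'h"
  where "left_lact s a h = s a * h"

definition left_ract :: "('a \<Rightarrow> 'h::times) \<Rightarrow> 'h \<Rightarrow> 'a \<Rightarrow> 'h"
  where "left_ract t h a = t a * h"

definition right_lact :: "('a \<Rightarrow> 'h::times) \<Rightarrow> 'a \<Rightarrow> 'h \<Rightarrow> 'h"
  where "right_lact t a h = h * t a"

definition right_ract :: "('a \<Rightarrow> 'h::times) \<Rightarrow> 'h \<Rightarrow> 'a \<Rightarrow> 'h"
  where "right_ract s h a = h * s a"

text \<open>
  In both bialgebroid locales, \<open>comult_takeuchi\<close> says that \<open>D\<close> takes values in the Takeuchi product,
  on which componentwise multiplication is well defined.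
\<close>

locale left_bialgebroid =
  fixes scaleA :: "'k::field \<Rightarrow> 'a::{ring, monoid_mult} \<Rightarrow> 'a"
    and scaleH :: "'k \<Rightarrow> 'h::{ring, monoid_mult} \<Rightarrow> 'h"
    and s t :: "'a \<Rightarrow> 'h"
    and D :: "'h \<Rightarrow> ('h \<times> 'h) list"
    and e :: "'h \<Rightarrow> 'a"
  assumes base_algebra: "unital_algebra scaleA"
    and total_algebra: "unital_algebra scaleH"
    and source: "algebra_morphism scaleA scaleH s"
    and target: "algebra_antimorphism scaleA scaleH t"
    and source_target_commute: "s a * t b = t b * s a"
    and coring: "coring (left_lact s) (left_ract t) D e"
    and comult_takeuchi: "tensor_eq UNIV UNIV (left_ract t) (left_lact s)
           [(x * t a, y). (x, y) \<leftarrow> D h] [(x, y * s a). (x, y) \<leftarrow> D h]"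
    and comult_mult: "tensor_eq UNIV UNIV (left_ract t) (left_lact s)
           (D (h * k)) (tensor_mult (*) (D h) (D k))"
    and comult_one: "tensor_eq UNIV UNIV (left_ract t) (left_lact s) (D 1) [(1, 1)]"
    and counit_mult_source: "e (h * k) = e (h * s (e k))"
    and counit_mult_target: "e (h * k) = e (h * t (e k))"

locale right_bialgebroid =
  fixes scaleA :: "'k::field \<Rightarrow> 'a::{ring, monoid_mult} \<Rightarrow> 'a"
    and scaleH :: "'k \<Rightarrow> 'h::{ring, monoid_mult} \<Rightarrow> 'h"
    and s t :: "'a \<Rightarrow> 'h"
    and D :: "'h \<Rightarrow> ('h \<times> 'h) list"
    and e :: "'h \<Rightarrow> 'a"
  assumes base_algebra: "unital_algebra scaleA"
    and total_algebra: "unital_algebra scaleH"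
    and source: "algebra_morphism scaleA scaleH s"
    and target: "algebra_antimorphism scaleA scaleH t"
    and source_target_commute: "s a * t b = t b * s a"
    and coring: "coring (right_lact t) (right_ract s) D e"
    and comult_takeuchi: "tensor_eq UNIV UNIV (right_ract s) (right_lact t)
           [(s a * x, y). (x, y) \<leftarrow> D h] [(x, t a * y). (x, y) \<leftarrow> D h]"
    and comult_mult: "tensor_eq UNIV UNIV (right_ract s) (right_lact t)
           (D (h * k)) (tensor_mult (*) (D h) (D k))"
    and comult_one: "tensor_eq UNIV UNIV (right_ract s) (right_lact t) (D 1) [(1, 1)]"
    and counit_mult_source: "e (h * k) = e (s (e h) * k)"
    and counit_mult_target: "e (h * k) = e (t (e h) * k)"

locale hopf_algebroid =
  fixes scaleA :: "'k::field \<Rightarrow> 'a::{comm_ring, comm_monoid_mult} \<Rightarrow> 'a"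
    and scaleH :: "'k \<Rightarrow> 'h::{ring, monoid_mult} \<Rightarrow> 'h"
    and sl tl :: "'a \<Rightarrow> 'h" and Dl :: "'h \<Rightarrow> ('h \<times> 'h) list" and el :: "'h \<Rightarrow> 'a"
    and sr tr :: "'a \<Rightarrow> 'h" and Dr :: "'h \<Rightarrow> ('h \<times> 'h) list" and er :: "'h \<Rightarrow> 'a"
    and S :: "'h \<Rightarrow> 'h"
  assumes left: "left_bialgebroid scaleA scaleH sl tl Dl el"
    and right: "right_bialgebroid scaleA scaleH sr tr Dr er"
    and antipode_linear: "Vector_Spaces.linear scaleH scaleH S"
    and sl_el_tr: "sl (el (tr a)) = tr a"
    and tl_el_sr: "tl (el (sr a)) = sr a"
    and sr_er_tl: "sr (er (tl a)) = tl a"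
    and tr_er_sl: "tr (er (sl a)) = sl a"
    and coassoc_left_right:
          "tensor3_eq UNIV UNIV UNIV (left_ract tl) (left_lact sl) (right_ract sr) (right_lact tr)
             (map_left Dl (Dr h)) (map_right Dr (Dl h))"
    and coassoc_right_left:
          "tensor3_eq UNIV UNIV UNIV (right_ract sr) (right_lact tr) (left_ract tl) (left_lact sl)
             (map_left Dr (Dl h)) (map_right Dl (Dr h))"
    and antipode_bimodule: "S (tl a * h * tr b) = sr b * S h * sl a"
    and antipode_left: "(\<Sum>(x, y)\<leftarrow>Dl h. S x * y) = sr (er h)"
    and antipode_right: "(\<Sum>(x, y)\<leftarrow>Dr h. x * S y) = sl (el h)"


section \<open>Local biretractions\<close>

text \<open>Here \<open>s = s\<^sub>r = t\<^sub>l\<close> and \<open>t = s\<^sub>l = t\<^sub>r\<close>.\<close>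

definition Brt ::
  "('k::field \<Rightarrow> 'a::{comm_ring, comm_monoid_mult} \<Rightarrow> 'a)
    \<Rightarrow> ('k \<Rightarrow> 'h::{ring, monoid_mult} \<Rightarrow> 'h) \<Rightarrow> ('a \<Rightarrow> 'h) \<Rightarrow> ('a \<Rightarrow> 'h) \<Rightarrow> ('h \<Rightarrow> 'a) set"
where
  "Brt scaleA scaleH s t = {\<alpha>.
     Vector_Spaces.linear scaleH scaleA \<alpha> \<and>
     (\<forall>h k. \<alpha> (h * k) = \<alpha> h * \<alpha> k) \<and>
     (\<forall>a. \<alpha> (s a) = a * \<alpha> 1) \<and>
     (\<exists>e. \<alpha> (t e) = \<alpha> 1 \<and>
          bij_betw (\<lambda>x. \<alpha> (t x)) (range (\<lambda>a. a * e)) (range (\<lambda>a. a * \<alpha> 1)))}"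

definition convolution ::
  "('a::{comm_ring, comm_monoid_mult} \<Rightarrow> 'h) \<Rightarrow> ('h \<Rightarrow> ('h \<times> 'h) list)
    \<Rightarrow> ('h \<Rightarrow> 'a) \<Rightarrow> ('h \<Rightarrow> 'a) \<Rightarrow> 'h \<Rightarrow> 'a"
where
  "convolution t Dl \<alpha> \<beta> h = (\<Sum>(x, y)\<leftarrow>Dl h. \<beta> (t (\<alpha> x)) * \<beta> y)"

text \<open>
  The free vector space on a set \<open>X\<close>, its scalar multiplication, and the bilinear extension of a
  binary operation on the basis.
\<close>

definition free_space :: "'x set \<Rightarrow> ('x \<Rightarrow>\<^sub>0 'k::field) set"
  where "free_space X = {f. Poly_Mapping.keys f \<subseteq> X}"

definition free_scale :: "'k::field \<Rightarrow> ('x \<Rightarrow>\<^sub>0 'k) \<Rightarrow> ('x \<Rightarrow>\<^sub>0 'k)"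
  where "free_scale c f = Poly_Mapping.map ((*) c) f"

definition free_mult ::
  "('x \<Rightarrow> 'x \<Rightarrow> 'x) \<Rightarrow> ('x \<Rightarrow>\<^sub>0 'k::field) \<Rightarrow> ('x \<Rightarrow>\<^sub>0 'k) \<Rightarrow> ('x \<Rightarrow>\<^sub>0 'k)"
where
  "free_mult m f g =
     (\<Sum>\<alpha>\<in>Poly_Mapping.keys f. \<Sum>\<beta>\<in>Poly_Mapping.keys g.
        Poly_Mapping.single (m \<alpha> \<beta>) (Poly_Mapping.lookup f \<alpha> * Poly_Mapping.lookup g \<beta>))"


section \<open>Quantum inverse semigroups\<close>

text \<open>
  The algebra is a subspace \<open>Q\<close> of a vector space given by a type; \<open>m\<close>, \<open>D\<close> and \<open>S\<close> matter only on
  \<open>Q\<close>. The tensor products are formed over the field and from \<open>Q\<close> only.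
\<close>

abbreviation tensor_eq_over ::
  "('k \<Rightarrow> 'q::ab_group_add \<Rightarrow> 'q) \<Rightarrow> 'q set \<Rightarrow> ('q \<times> 'q) list \<Rightarrow> ('q \<times> 'q) list \<Rightarrow> bool"
  where "tensor_eq_over scale Q \<equiv> tensor_eq Q Q (\<lambda>x c. scale c x) scale"

locale quantum_inverse_semigroup = vector_space scale
  for scale :: "'k::field \<Rightarrow> 'q::ab_group_add \<Rightarrow> 'q" +
  fixes Q :: "'q set"
    and m :: "'q \<Rightarrow> 'q \<Rightarrow> 'q"
    and D :: "'q \<Rightarrow> ('q \<times> 'q) list"
    and S :: "'q \<Rightarrow> 'q"
  assumes subspace: "subspace Q"
    and mult_closed: "p \<in> Q \<Longrightarrow> q \<in> Q \<Longrightarrow> m p q \<in> Q"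
    and mult_add_left: "p \<in> Q \<Longrightarrow> p' \<in> Q \<Longrightarrow> q \<in> Q \<Longrightarrow> m (p + p') q = m p q + m p' q"
    and mult_add_right: "p \<in> Q \<Longrightarrow> q \<in> Q \<Longrightarrow> q' \<in> Q \<Longrightarrow> m p (q + q') = m p q + m p q'"
    and mult_scale_left: "p \<in> Q \<Longrightarrow> q \<in> Q \<Longrightarrow> m (scale c p) q = scale c (m p q)"
    and mult_scale_right: "p \<in> Q \<Longrightarrow> q \<in> Q \<Longrightarrow> m p (scale c q) = scale c (m p q)"
    and mult_assoc: "p \<in> Q \<Longrightarrow> q \<in> Q \<Longrightarrow> r \<in> Q \<Longrightarrow> m (m p q) r = m p (m q r)"
    and comult_closed: "q \<in> Q \<Longrightarrow> D q \<in> lists (Q \<times> Q)"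
    and comult_add: "p \<in> Q \<Longrightarrow> q \<in> Q \<Longrightarrow> tensor_eq_over scale Q (D (p + q)) (D p @ D q)"
    and comult_scale: "q \<in> Q \<Longrightarrow>
          tensor_eq_over scale Q (D (scale c q)) [(scale c x, y). (x, y) \<leftarrow> D q]"
    and comult_mult: "p \<in> Q \<Longrightarrow> q \<in> Q \<Longrightarrow>
          tensor_eq_over scale Q (D (m p q)) (tensor_mult m (D p) (D q))"
    and comult_coassoc: "q \<in> Q \<Longrightarrow>
          tensor3_eq Q Q Q (\<lambda>x c. scale c x) scale (\<lambda>x c. scale c x) scale
            (map_left D (D q)) (map_right D (D q))"
    and antipode_closed: "q \<in> Q \<Longrightarrow> S q \<in> Q"
    and antipode_add: "p \<in> Q \<Longrightarrow> q \<in> Q \<Longrightarrow> S (p + q) = S p + S q"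
    and antipode_scale: "q \<in> Q \<Longrightarrow> S (scale c q) = scale c (S q)"
    and antipode_mult: "p \<in> Q \<Longrightarrow> q \<in> Q \<Longrightarrow> S (m p q) = m (S q) (S p)"
    and regular: "q \<in> Q \<Longrightarrow>
          (\<Sum>(x, y, z)\<leftarrow>map_left D (D q). m (m x (S y)) z) = q"
    and antipode_regular: "q \<in> Q \<Longrightarrow>
          (\<Sum>(x, y, z)\<leftarrow>map_left D (D q). m (m (S x) y) (S z)) = S q"
    and commute: "p \<in> Q \<Longrightarrow> q \<in> Q \<Longrightarrow>
          m (\<Sum>(x, y)\<leftarrow>D p. m x (S y)) (\<Sum>(x, y)\<leftarrow>D q. m (S x) y) =
          m (\<Sum>(x, y)\<leftarrow>D q. m (S x) y) (\<Sum>(x, y)\<leftarrow>D p. m x (S y))"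

end

theory Submission
  imports Defs "HOL-Library.Multiset"
begin

text \<open>
  The local biretractions form an inverse semigroup under convolution, and the algebra of any
  inverse semigroup is a quantum inverse semigroup: let the basis elements be group-like and let the
  pseudo-antipode be the linear extension of the inversion. What has to be found is the inverse of
  a local biretraction \<open>\<alpha>\<close>.

  Write \<open>*\<^sub>l\<close> and \<open>*\<^sub>r\<close> for the convolutions formed with \<open>\<Delta>\<^sub>l\<close> and \<open>\<Delta>\<^sub>r\<close>, put \<open>p = \<alpha>(1)\<close>, and let
  \<open>\<psi> : A \<rightarrow> Ae\<close> be the inverse of \<open>\<alpha> \<circ> t : Ae \<rightarrow> Ap\<close>, precomposed with the multiplication by \<open>p\<close>.
  The obvious candidate for the inverse is \<open>\<alpha>\<^sup>\<star> = \<psi> \<circ> \<alpha> \<circ> S\<close>. The antipode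
  axioms give \<open>\<alpha> *\<^sub>r \<alpha>\<^sup>\<star> = \<epsilon>\<^sub>l e\<close> and \<open>\<alpha>\<^sup>\<star> *\<^sub>l \<alpha> = \<epsilon>\<^sub>r p\<close>
  (\<open>conv_right_star\<close>, \<open>conv_left_star\<close>), but they mix the two convolutions, and \<open>\<alpha>\<^sup>\<star>\<close> is not an
  inverse for \<open>*\<^sub>l\<close> in general. For example, if \<open>\<chi>\<close> is a character of a group \<open>G\<close>, then the group
  algebra with \<open>\<Delta>\<^sub>l(g) = g \<otimes> g\<close>, \<open>\<Delta>\<^sub>r(g) = \<chi>(g) g \<otimes> g\<close> and \<open>S(g) = \<chi>(g)\<^sup>-\<^sup>1 g\<^sup>-\<^sup>1\<close> is a Hopf algebroid
  over the field, its local biretractions are \<open>0\<close> and the characters of \<open>G\<close>, and \<open>\<alpha>\<^sup>\<star>\<close> is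
  \<open>\<chi>\<^sup>-\<^sup>1 \<alpha>\<^sup>-\<^sup>1\<close> for such a character \<open>\<alpha>\<close>.

  The convolutions are related by the mixed coassociativity of \<open>\<Delta>\<^sub>l\<close> and \<open>\<Delta>\<^sub>r\<close>, which says
  \<open>(\<alpha> *\<^sub>l \<beta>) *\<^sub>r \<gamma> = \<alpha> *\<^sub>l (\<beta> *\<^sub>r \<gamma>)\<close> and the same with the roles exchanged (\<open>conv_assoc\<close>). The
  functions \<open>\<epsilon>\<^sub>l e\<close> and \<open>\<epsilon>\<^sub>l p\<close> are local biretractions and act as the left and the right unit of
  \<open>\<alpha>\<close> for \<open>*\<^sub>l\<close>, while \<open>\<epsilon>\<^sub>r p\<close> is a right unit of \<open>\<epsilon>\<^sub>l p\<close> for \<open>*\<^sub>r\<close>. So \<open>\<beta> = \<epsilon>\<^sub>l p *\<^sub>r \<alpha>\<^sup>\<star>\<close> satisfies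
  \<open>\<alpha> *\<^sub>l \<beta> = (\<alpha> *\<^sub>l \<epsilon>\<^sub>l p) *\<^sub>r \<alpha>\<^sup>\<star> = \<alpha> *\<^sub>r \<alpha>\<^sup>\<star> = \<epsilon>\<^sub>l e\<close> and
  \<open>\<beta> *\<^sub>l \<alpha> = \<epsilon>\<^sub>l p *\<^sub>r (\<alpha>\<^sup>\<star> *\<^sub>l \<alpha>) = \<epsilon>\<^sub>l p *\<^sub>r \<epsilon>\<^sub>r p = \<epsilon>\<^sub>l p\<close> (\<open>brt_inverse\<close>). Since
  \<open>\<epsilon>\<^sub>l q *\<^sub>l \<epsilon>\<^sub>l r = \<epsilon>\<^sub>l qr\<close> for the units so obtained, the projections commute, and this is
  enough for an inverse semigroup (\<open>inverse_semigroup_on\<close>).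

  The remaining point is that \<open>\<alpha>\<^sup>\<star>\<close> is multiplicative. For this \<open>\<alpha>(S(hk)) = \<alpha>(S(h)) \<alpha>(S(k))\<close> is
  derived by the usual uniqueness argument for convolution inverses, carried out inside \<open>A\<close>
  (\<open>antipode_mult_brt\<close>). The counits need not be multiplicative, but \<open>\<epsilon>\<^sub>r p\<close> and \<open>\<epsilon>\<^sub>l e\<close> are
  (\<open>er_mult_brt\<close>, \<open>el_mult_brt\<close>).
\<close>


section \<open>Formal sums\<close>

text \<open>
  The way to use an equality of tensors: it is preserved by every additive functional that respects
  the defining relations.
\<close>

lemma fsum_eq_sum_list:
  fixes f :: "'e \<Rightarrow> 'c::comm_monoid_add"
  assumes "fsum_eq E R us vs"
    and "\<And>us vs. (us, vs) \<in> R \<Longrightarrow> sum_list (map f us) = sum_list (map f vs)"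
  shows "sum_list (map f us) = sum_list (map f vs)"
  using assms(1) by induction (simp_all add: assms(2) add.commute)

lemma tensor_eq_sum_list:
  fixes f :: "'m::ab_group_add \<Rightarrow> 'n::ab_group_add \<Rightarrow> 'c::ab_group_add"
  assumes "tensor_eq M N ract lact us vs"
    and left: "\<And>x x' y. f (x + x') y = f x y + f x' y"
    and right: "\<And>x y y'. f x (y + y') = f x y + f x y'"
    and balanced: "\<And>x a y. f (ract x a) y = f x (lact a y)"
  shows "(\<Sum>(x, y)\<leftarrow>us. f x y) = (\<Sum>(x, y)\<leftarrow>vs. f x y)"
proof (rule fsum_eq_sum_list[OF assms(1)[unfolded tensor_eq_def]])
  have [simp]: "f 0 y = 0" "f x 0 = 0" for x y
    using left[of 0 0 y] right[of x 0 0] by simp_all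
  show "(\<Sum>(x, y)\<leftarrow>us. f x y) = (\<Sum>(x, y)\<leftarrow>vs. f x y)"
    if "(us, vs) \<in> tensor_rel M N ract lact" for us vs
    using that unfolding tensor_rel_def by (auto simp: left right balanced)
qed

lemma tensor3_eq_sum_list:
  fixes f :: "'m::ab_group_add \<Rightarrow> 'n::ab_group_add \<Rightarrow> 'p::ab_group_add \<Rightarrow> 'c::ab_group_add"
  assumes "tensor3_eq M N P ract lact ract' lact' us vs"
    and first: "\<And>x x' y z. f (x + x') y z = f x y z + f x' y z"
    and second: "\<And>x y y' z. f x (y + y') z = f x y z + f x y' z"
    and third: "\<And>x y z z'. f x y (z + z') = f x y z + f x y z'"
    and balanced: "\<And>x a y z. f (ract x a) y z = f x (lact a y) z"
    and balanced': "\<And>x a y z. f x (ract' y a) z = f x y (lact' a z)"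
  shows "(\<Sum>(x, y, z)\<leftarrow>us. f x y z) = (\<Sum>(x, y, z)\<leftarrow>vs. f x y z)"
proof (rule fsum_eq_sum_list[OF assms(1)[unfolded tensor3_eq_def]])
  have [simp]: "f 0 y z = 0" "f x 0 z = 0" "f x y 0 = 0" for x y z
    using first[of 0 0 y z] second[of x 0 0 z] third[of x y 0 0] by simp_all
  show "(\<Sum>(x, y, z)\<leftarrow>us. f x y z) = (\<Sum>(x, y, z)\<leftarrow>vs. f x y z)"
    if "(us, vs) \<in> tensor3_rel M N P ract lact ract' lact'" for us vs
    using that unfolding tensor3_rel_def by (auto simp: first second third balanced balanced')
qed

lemma fsum_eq_permute:
  assumes "mset us = mset vs" "us \<in> lists E"
  shows "fsum_eq E R us vs"
  using assms
proof (induction us arbitrary: vs)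
  case Nil
  then show ?case using fsum_eq.refl[of "[]"] by auto
next
  case (Cons u us)
  then have "u \<in> set vs"
    by (metis list.set_intros(1) mset_eq_setD)
  then obtain ys zs where vs: "vs = ys @ u # zs"
    by (meson split_list)
  then have "mset us = mset (ys @ zs)"
    using Cons.prems by simp
  moreover have E: "u \<in> E" "us \<in> lists E"
    using Cons.prems by auto
  ultimately have "fsum_eq E R ([u] @ us) ([u] @ (ys @ zs))"
    by (intro fsum_eq.add Cons.IH fsum_eq.refl) auto
  moreover have "fsum_eq E R (([u] @ ys) @ zs) ((ys @ [u]) @ zs)"
  proof -
    have "set vs \<subseteq> E"
      using Cons.prems by (metis in_lists_conv_set mset_eq_setD subsetI)
    then show ?thesis
      unfolding vs by (intro fsum_eq.add fsum_eq.comm fsum_eq.refl) auto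
  qed
  ultimately show ?case
    unfolding vs by (auto intro: fsum_eq.trans)
qed

lemma sum_list_map_left:
  "(\<Sum>(x1, x2, y)\<leftarrow>map_left D us. f x1 x2 y) = (\<Sum>(x, y)\<leftarrow>us. \<Sum>(x1, x2)\<leftarrow>D x. f x1 x2 y)"
  unfolding map_left_def
  by (induction us) (auto simp: o_def case_prod_unfold)

lemma sum_list_map_right:
  "(\<Sum>(x, y1, y2)\<leftarrow>map_right D us. f x y1 y2) = (\<Sum>(x, y)\<leftarrow>us. \<Sum>(y1, y2)\<leftarrow>D y. f x y1 y2)"
  unfolding map_right_def
  by (induction us) (auto simp: o_def case_prod_unfold)

lemma sum_list_tensor_mult:
  "(\<Sum>(x, y)\<leftarrow>tensor_mult m us vs. f x y) =
     (\<Sum>(x, y)\<leftarrow>us. \<Sum>(x', y')\<leftarrow>vs. f (m x x') (m y y'))"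
  unfolding tensor_mult_def
  by (induction us) (auto simp: o_def case_prod_unfold)


section \<open>Inverse semigroups and their algebras\<close>

text \<open>
  Instead of the commutativity of all idempotents, only that of the projections \<open>x x\<^sup>-\<^sup>1\<close> with the
  projections \<open>y\<^sup>-\<^sup>1 y\<close> is assumed. This is the form in which it enters a quantum inverse semigroup,
  and it is equivalent, because every idempotent is a projection of both kinds.
\<close>

locale inverse_semigroup_on =
  fixes X :: "'x set" and m :: "'x \<Rightarrow> 'x \<Rightarrow> 'x" and inv :: "'x \<Rightarrow> 'x"
  assumes closed: "x \<in> X \<Longrightarrow> y \<in> X \<Longrightarrow> m x y \<in> X"
    and assoc: "x \<in> X \<Longrightarrow> y \<in> X \<Longrightarrow> z \<in> X \<Longrightarrow> m (m x y) z = m x (m y z)"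
    and inv_closed: "x \<in> X \<Longrightarrow> inv x \<in> X"
    and regular: "x \<in> X \<Longrightarrow> m (m x (inv x)) x = x"
    and inv_regular: "x \<in> X \<Longrightarrow> m (m (inv x) x) (inv x) = inv x"
    and projections_commute: "x \<in> X \<Longrightarrow> y \<in> X \<Longrightarrow>
          m (m x (inv x)) (m (inv y) y) = m (m (inv y) y) (m x (inv x))"
begin

text \<open>
  Let \<open>a = f\<^sup>-\<^sup>1 f\<close> and \<open>b = f f\<^sup>-\<^sup>1\<close>. For an idempotent \<open>f\<close> one has \<open>f\<^sup>-\<^sup>1 = f\<^sup>-\<^sup>1 f f f\<^sup>-\<^sup>1 = a b\<close>, and as
  \<open>a\<close> and \<open>b\<close> commute, \<open>a = f\<^sup>-\<^sup>1 f = b a f = b a\<close> and \<open>b = f f\<^sup>-\<^sup>1 = f b a = b a\<close>. So \<open>a = b\<close>, and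
  hence \<open>f = b f = a f = a\<close>.
\<close>

lemma idempotent_projection:
  assumes f: "f \<in> X" "m f f = f"
  shows "m f (inv f) = f" "m (inv f) f = f"
proof -
  define a b where "a = m (inv f) f" and "b = m f (inv f)"
  note [simp] = closed inv_closed f
  have ab: "a \<in> X" "b \<in> X" "m a b = m b a"
    unfolding a_def b_def using projections_commute[of f f] by simp_all
  have "m f b = b"
    unfolding b_def by (metis assoc f inv_closed)
  have "m a f = a"
    unfolding a_def by (metis assoc f inv_closed)
  have "m f a = f" "m b f = f"
    unfolding a_def b_def using regular[of f] by (simp_all add: assoc)
  have f': "inv f = m a b"
    unfolding a_def b_def using inv_regular[of f] by (metis assoc closed f inv_closed)
  have "a = m b a"
    using f' ab \<open>m a f = a\<close> unfolding a_def by (metis assoc f(1))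
  moreover have "b = m b a"
    using f' ab \<open>m f b = b\<close> unfolding b_def by (metis assoc f(1))
  ultimately have "a = b" by simp
  then have "f = a"
    using \<open>m b f = f\<close> \<open>m a f = a\<close> by simp
  then show "m f (inv f) = f" "m (inv f) f = f"
    using \<open>a = b\<close> unfolding a_def b_def by auto
qed

lemma idempotents_commute:
  assumes "f \<in> X" "m f f = f" "g \<in> X" "m g g = g"
  shows "m f g = m g f"
  using projections_commute[of f g] idempotent_projection assms by simp

text \<open>
  Both \<open>w\<close> and \<open>x\<^sup>-\<^sup>1\<close> equal \<open>w x x\<^sup>-\<^sup>1\<close>, by the commutation of the idempotents \<open>x w\<close>, \<open>x x\<^sup>-\<^sup>1\<close> and
  \<open>w x\<close>, \<open>x\<^sup>-\<^sup>1 x\<close>.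
\<close>

lemma inv_unique:
  assumes X: "x \<in> X" "w \<in> X" and x: "m (m x w) x = x" and w: "m (m w x) w = w"
  shows "w = inv x"
proof -
  note [simp] = closed inv_closed X
  have idem: "m (m x w) (m x w) = m x w" "m (m w x) (m w x) = m w x"
    "m (m x (inv x)) (m x (inv x)) = m x (inv x)" "m (m (inv x) x) (m (inv x) x) = m (inv x) x"
    using x w regular[of x] inv_regular[of x] by (simp_all flip: assoc)
  have "w = m w (m (m x (inv x)) (m x w))"
    using w regular[of x] by (simp flip: assoc)
  also have "\<dots> = m w (m (m x w) (m x (inv x)))"
    using idempotents_commute idem by simp
  also have "\<dots> = m (m w x) (inv x)"
    using w by (simp flip: assoc)
  also have "\<dots> = m (m (m w x) (m (inv x) x)) (inv x)"
    using inv_regular[of x] by (simp add: assoc)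
  also have "\<dots> = m (m (m (inv x) x) (m w x)) (inv x)"
    using idempotents_commute idem by simp
  also have "\<dots> = inv x"
    using x inv_regular[of x] by (simp add: assoc)
  finally show ?thesis .
qed

lemma inv_mult:
  assumes X: "x \<in> X" "y \<in> X"
  shows "inv (m x y) = m (inv y) (inv x)"
proof (rule inv_unique[symmetric])
  note [simp] = closed inv_closed X
  have comm: "m (m (inv x) x) (m y (inv y)) = m (m y (inv y)) (m (inv x) x)"
    using projections_commute[of y x] by simp
  have "m (m (m x y) (m (inv y) (inv x))) (m x y) = m x (m (m (m y (inv y)) (m (inv x) x)) y)"
    by (simp add: assoc)
  also have "\<dots> = m (m (m x (inv x)) x) (m (m y (inv y)) y)"
    by (simp flip: comm) (simp add: assoc)
  finally show "m (m (m x y) (m (inv y) (inv x))) (m x y) = m x y"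
    by (simp add: regular)
  have "m (m (m (inv y) (inv x)) (m x y)) (m (inv y) (inv x)) =
      m (inv y) (m (m (m (inv x) x) (m y (inv y))) (inv x))"
    by (simp add: assoc)
  also have "\<dots> = m (m (m (inv y) y) (inv y)) (m (m (inv x) x) (inv x))"
    by (simp add: comm) (simp add: assoc)
  finally show "m (m (m (inv y) (inv x)) (m x y)) (m (inv y) (inv x)) = m (inv y) (inv x)"
    by (simp add: inv_regular)
qed (use X in \<open>simp_all add: closed inv_closed\<close>)

end


section \<open>The quantum inverse semigroup of an inverse semigroup\<close>

lemma lookup_free_scale: "Poly_Mapping.lookup (free_scale c f) x = c * Poly_Mapping.lookup f x"
  unfolding free_scale_def by (auto simp: Poly_Mapping.map.rep_eq when_def)

lemma free_scale_single: "free_scale c (Poly_Mapping.single x a) = Poly_Mapping.single x (c * a)"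
  unfolding free_scale_def by simp

lemma vector_space_free_scale: "vector_space free_scale"
  by unfold_locales
    (rule poly_mapping_eqI, simp add: lookup_free_scale lookup_add algebra_simps)+

lemma keys_free_scale: "Poly_Mapping.keys (free_scale c f) \<subseteq> Poly_Mapping.keys f"
  by (auto simp: in_keys_iff lookup_free_scale)

lemma single_in_free_space: "x \<in> X \<Longrightarrow> Poly_Mapping.single x c \<in> free_space X"
  unfolding free_space_def by simp

lemma subspace_free_space: "module.subspace free_scale (free_space X)"
proof -
  interpret vector_space free_scale by (rule vector_space_free_scale)
  show ?thesis
  proof (rule subspaceI)
    show "f + g \<in> free_space X" if "f \<in> free_space X" "g \<in> free_space X" for f g
      using that keys_add[of f g] unfolding free_space_def by auto
    show "free_scale c f \<in> free_space X" if "f \<in> free_space X" for c f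
      using that keys_free_scale[of c f] unfolding free_space_def by auto
  qed (simp add: free_space_def)
qed

lemma free_space_sum: "(\<And>i. i \<in> I \<Longrightarrow> f i \<in> free_space X) \<Longrightarrow> sum f I \<in> free_space X"
proof -
  interpret vector_space free_scale by (rule vector_space_free_scale)
  show "(\<And>i. i \<in> I \<Longrightarrow> f i \<in> free_space X) \<Longrightarrow> sum f I \<in> free_space X"
    using subspace_sum[OF subspace_free_space] by blast
qed

lemma free_scale_sum: "free_scale c (sum f I) = (\<Sum>i\<in>I. free_scale c (f i))"
  by (rule poly_mapping_eqI) (simp add: lookup_free_scale lookup_sum sum_distrib_left)

lemma sum_single_superset:
  assumes "finite F" "Poly_Mapping.keys f \<subseteq> F"
  shows "(\<Sum>x\<in>F. Poly_Mapping.single x (Poly_Mapping.lookup f x)) = f"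
  using assms
  by (intro poly_mapping_eqI)
    (auto simp: lookup_sum lookup_single when_def in_keys_iff subset_iff)

text \<open>
  The sums in the product may run over any finite sets containing the supports, so the summands of
  a sum can be given common index sets. This makes the bilinearity evident.
\<close>

lemma free_mult_superset:
  assumes "finite F" "Poly_Mapping.keys f \<subseteq> F" "finite G" "Poly_Mapping.keys g \<subseteq> G"
  shows "free_mult m f g = (\<Sum>x\<in>F. \<Sum>y\<in>G.
           Poly_Mapping.single (m x y) (Poly_Mapping.lookup f x * Poly_Mapping.lookup g y))"
proof -
  have "free_mult m f g = (\<Sum>x\<in>F. \<Sum>y\<in>Poly_Mapping.keys g.
           Poly_Mapping.single (m x y) (Poly_Mapping.lookup f x * Poly_Mapping.lookup g y))"
    unfolding free_mult_def using assms
    by (intro sum.mono_neutral_left) (auto simp: in_keys_iff)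
  also have "\<dots> = (\<Sum>x\<in>F. \<Sum>y\<in>G.
           Poly_Mapping.single (m x y) (Poly_Mapping.lookup f x * Poly_Mapping.lookup g y))"
    using assms
    by (intro sum.cong sum.mono_neutral_left) (auto simp: in_keys_iff)
  finally show ?thesis .
qed

lemma free_mult_add_left: "free_mult m (f + f') g = free_mult m f g + free_mult m f' g"
proof -
  define F where "F = Poly_Mapping.keys f \<union> Poly_Mapping.keys f'"
  have F: "finite F" "Poly_Mapping.keys f \<subseteq> F" "Poly_Mapping.keys f' \<subseteq> F"
    "Poly_Mapping.keys (f + f') \<subseteq> F"
    unfolding F_def using keys_add[of f f'] by auto
  show ?thesis
    by (simp add: free_mult_superset[OF F(1) _ finite_keys order.refl] F lookup_add distrib_right
        single_add sum.distrib)
qed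

lemma free_mult_add_right: "free_mult m f (g + g') = free_mult m f g + free_mult m f g'"
proof -
  define G where "G = Poly_Mapping.keys g \<union> Poly_Mapping.keys g'"
  have G: "finite G" "Poly_Mapping.keys g \<subseteq> G" "Poly_Mapping.keys g' \<subseteq> G"
    "Poly_Mapping.keys (g + g') \<subseteq> G"
    unfolding G_def using keys_add[of g g'] by auto
  show ?thesis
    by (simp add: free_mult_superset[OF finite_keys order.refl G(1)] G lookup_add distrib_left
        single_add sum.distrib)
qed

lemma free_mult_sum_left: "free_mult m (sum f I) g = (\<Sum>i\<in>I. free_mult m (f i) g)"
proof -
  have "free_mult m 0 g = 0" unfolding free_mult_def by simp
  then show ?thesis
    by (induction I rule: infinite_finite_induct) (simp_all add: free_mult_add_left)
qed

lemma free_mult_sum_right: "free_mult m f (sum g I) = (\<Sum>i\<in>I. free_mult m f (g i))"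
proof -
  have "free_mult m f 0 = 0" unfolding free_mult_def by simp
  then show ?thesis
    by (induction I rule: infinite_finite_induct) (simp_all add: free_mult_add_right)
qed

lemma free_mult_single:
  "free_mult m (Poly_Mapping.single x a) (Poly_Mapping.single y b) =
     Poly_Mapping.single (m x y) (a * b)"
  unfolding free_mult_def by auto

lemma free_mult_scale_left: "free_mult m (free_scale c f) g = free_scale c (free_mult m f g)"
  unfolding free_mult_superset[OF finite_keys keys_free_scale finite_keys order.refl] free_mult_def[of m f g]
  by (simp add: free_scale_sum free_scale_single lookup_free_scale mult.assoc)

lemma free_mult_scale_right: "free_mult m f (free_scale c g) = free_scale c (free_mult m f g)"
  unfolding free_mult_superset[OF finite_keys order.refl finite_keys keys_free_scale] free_mult_def[of m f g]
  by (simp add: free_scale_sum free_scale_single lookup_free_scale mult.left_commute)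

lemma free_mult_closed:
  assumes "\<And>x y. x \<in> X \<Longrightarrow> y \<in> X \<Longrightarrow> m x y \<in> X" "f \<in> free_space X" "g \<in> free_space X"
  shows "free_mult m f g \<in> free_space X"
  unfolding free_mult_def
  using assms by (intro free_space_sum single_in_free_space) (auto simp: free_space_def)

lemma free_space_induct [consumes 1, case_names sum]:
  assumes "f \<in> free_space X"
    and "\<And>F c. finite F \<Longrightarrow> F \<subseteq> X \<Longrightarrow> P (\<Sum>x\<in>F. Poly_Mapping.single x (c x))"
  shows "P f"
  using assms(2)[of "Poly_Mapping.keys f" "Poly_Mapping.lookup f"] assms(1)
  by (simp add: sum_single_superset free_space_def)

lemma free_mult_assoc:
  assumes "\<And>x y z. x \<in> X \<Longrightarrow> y \<in> X \<Longrightarrow> z \<in> X \<Longrightarrow> m (m x y) z = m x (m y z)"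
    and "f \<in> free_space X" "g \<in> free_space X" "h \<in> free_space X"
  shows "free_mult m (free_mult m f g) h = free_mult m f (free_mult m g h)"
  using assms(2,3,4)
proof (induction f rule: free_space_induct)
  case f: (sum F a)
  from f(3,4) show ?case
  proof (induction g rule: free_space_induct)
    case g: (sum G b)
    from g(3) show ?case
    proof (induction h rule: free_space_induct)
      case h: (sum H c)
      have "m (m x y) z = m x (m y z)" if "x \<in> F" "y \<in> G" "z \<in> H" for x y z
        using that f g h by (intro assms(1)) auto
      then show ?case
        by (simp add: free_mult_sum_left free_mult_sum_right free_mult_single mult.assoc)
    qed
  qed
qed

definition free_map :: "('x \<Rightarrow> 'y) \<Rightarrow> ('x \<Rightarrow>\<^sub>0 'k::field) \<Rightarrow> ('y \<Rightarrow>\<^sub>0 'k)"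
  where "free_map \<phi> f =
    (\<Sum>x\<in>Poly_Mapping.keys f. Poly_Mapping.single (\<phi> x) (Poly_Mapping.lookup f x))"

lemma free_map_superset:
  assumes "finite F" "Poly_Mapping.keys f \<subseteq> F"
  shows "free_map \<phi> f = (\<Sum>x\<in>F. Poly_Mapping.single (\<phi> x) (Poly_Mapping.lookup f x))"
  unfolding free_map_def using assms
  by (intro sum.mono_neutral_left) (auto simp: in_keys_iff)

lemma free_map_add: "free_map \<phi> (f + g) = free_map \<phi> f + free_map \<phi> g"
proof -
  define F where "F = Poly_Mapping.keys f \<union> Poly_Mapping.keys g"
  have F: "finite F" "Poly_Mapping.keys f \<subseteq> F" "Poly_Mapping.keys g \<subseteq> F"
    "Poly_Mapping.keys (f + g) \<subseteq> F"
    unfolding F_def using keys_add[of f g] by auto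
  show ?thesis
    by (simp add: free_map_superset[OF F(1)] F lookup_add single_add sum.distrib)
qed

lemma free_map_sum: "free_map \<phi> (sum f I) = (\<Sum>i\<in>I. free_map \<phi> (f i))"
proof -
  have "free_map \<phi> 0 = 0" unfolding free_map_def by simp
  then show ?thesis
    by (induction I rule: infinite_finite_induct) (simp_all add: free_map_add)
qed

lemma free_map_single: "free_map \<phi> (Poly_Mapping.single x c) = Poly_Mapping.single (\<phi> x) c"
  unfolding free_map_def by simp

lemma free_map_scale: "free_map \<phi> (free_scale c f) = free_scale c (free_map \<phi> f)"
  unfolding free_map_superset[OF finite_keys keys_free_scale] free_map_def[of \<phi> f]
  by (simp add: free_scale_sum free_scale_single lookup_free_scale)

lemma free_map_closed:
  assumes "\<And>x. x \<in> X \<Longrightarrow> \<phi> x \<in> Y" "f \<in> free_space X"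
  shows "free_map \<phi> f \<in> free_space Y"
  unfolding free_map_def
  using assms by (intro free_space_sum single_in_free_space) (auto simp: free_space_def)

text \<open>
  The comultiplication is given by lists of summands, so the support has to be enumerated. The order
  is irrelevant up to equality of tensors.
\<close>

definition keys_list :: "('x \<Rightarrow>\<^sub>0 'k::zero) \<Rightarrow> 'x list"
  where "keys_list f = (SOME xs. set xs = Poly_Mapping.keys f \<and> distinct xs)"

lemma keys_list: "set (keys_list f) = Poly_Mapping.keys f" "distinct (keys_list f)"
proof -
  have "\<exists>xs. set xs = Poly_Mapping.keys f \<and> distinct xs"
    by (rule finite_distinct_list) simp
  from someI_ex[OF this] show "set (keys_list f) = Poly_Mapping.keys f" "distinct (keys_list f)"
    unfolding keys_list_def by auto
qed

lemma keys_list_single: "c \<noteq> 0 \<Longrightarrow> keys_list (Poly_Mapping.single x c) = [x]"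
  using keys_list[of "Poly_Mapping.single x c"]
  by (cases "keys_list (Poly_Mapping.single x c)") (auto dest: subset_singletonD)

definition grouplike_comult :: "('x \<Rightarrow>\<^sub>0 'k::field) \<Rightarrow> (('x \<Rightarrow>\<^sub>0 'k) \<times> ('x \<Rightarrow>\<^sub>0 'k)) list"
  where "grouplike_comult f =
    [(Poly_Mapping.single x (Poly_Mapping.lookup f x), Poly_Mapping.single x 1). x \<leftarrow> keys_list f]"

lemma grouplike_comult_single:
  "c \<noteq> 0 \<Longrightarrow> grouplike_comult (Poly_Mapping.single x c) =
     [(Poly_Mapping.single x c, Poly_Mapping.single x 1)]"
  unfolding grouplike_comult_def by (simp add: keys_list_single)

lemma map_left_grouplike_comult:
  "map_left grouplike_comult (grouplike_comult f) =
     [(Poly_Mapping.single x (Poly_Mapping.lookup f x), Poly_Mapping.single x 1,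
       Poly_Mapping.single x 1). x \<leftarrow> keys_list f]"
proof -
  have "map_left grouplike_comult [(Poly_Mapping.single x (Poly_Mapping.lookup f x),
            Poly_Mapping.single x 1). x \<leftarrow> xs] =
        [(Poly_Mapping.single x (Poly_Mapping.lookup f x), Poly_Mapping.single x 1,
            Poly_Mapping.single x 1). x \<leftarrow> xs]" if "set xs \<subseteq> Poly_Mapping.keys f" for xs
    using that unfolding map_left_def
    by (induction xs) (simp_all add: grouplike_comult_single in_keys_iff)
  from this[of "keys_list f"] show ?thesis
    unfolding grouplike_comult_def[of f] by (simp add: keys_list)
qed

lemma map_right_grouplike_comult:
  "map_right grouplike_comult (grouplike_comult f) =
     [(Poly_Mapping.single x (Poly_Mapping.lookup f x), Poly_Mapping.single x 1,
       Poly_Mapping.single x 1). x \<leftarrow> keys_list f]"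
  unfolding map_right_def grouplike_comult_def[of f]
  by (simp add: o_def grouplike_comult_single)

lemma grouplike_comult_closed:
  assumes "f \<in> free_space X"
  shows "grouplike_comult f \<in> lists (free_space X \<times> free_space X)"
proof -
  have "x \<in> X" if "x \<in> Poly_Mapping.keys f" for x
    using assms that by (auto simp: free_space_def)
  then show ?thesis
    unfolding grouplike_comult_def by (auto simp: keys_list intro!: single_in_free_space)
qed

text \<open>
  This makes the comultiplication linear: a zero coefficient contributes \<open>0 \<otimes> x\<close>, so the
  list of keys may be replaced by any list of basis elements containing it.
\<close>

lemma grouplike_comult_superset:
  assumes "set xs \<subseteq> X" "distinct xs" "Poly_Mapping.keys f \<subseteq> set xs"
  shows "tensor_eq_over free_scale (free_space X) (grouplike_comult f)
    [(Poly_Mapping.single x (Poly_Mapping.lookup f x), Poly_Mapping.single x 1). x \<leftarrow> xs]"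
proof -
  let ?g = "\<lambda>x. (Poly_Mapping.single x (Poly_Mapping.lookup f x), Poly_Mapping.single x (1::'b))"
  let ?E = "free_space X \<times> free_space X"
  let ?R = "tensor_rel (free_space X) (free_space X) (\<lambda>x c. free_scale c x) free_scale"
  have drop: "fsum_eq ?E ?R (map ?g (filter (\<lambda>x. x \<in> Poly_Mapping.keys f) ys)) (map ?g ys)"
    if "set ys \<subseteq> X" for ys
    using that
  proof (induction ys)
    case Nil
    show ?case by (simp add: fsum_eq.refl)
  next
    case (Cons y ys)
    have head: "fsum_eq ?E ?R (if y \<in> Poly_Mapping.keys f then [?g y] else []) [?g y]"
    proof (cases "y \<in> Poly_Mapping.keys f")
      case True
      then show ?thesis
        using Cons.prems by (auto intro!: fsum_eq.refl single_in_free_space)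
    next
      case False
      then have "([?g y], []) \<in> ?R"
        using Cons.prems unfolding tensor_rel_def
        by (auto simp: in_keys_iff intro!: single_in_free_space)
      then show ?thesis
        using False by (simp add: fsum_eq.sym fsum_eq.rel)
    qed
    from fsum_eq.add[OF head Cons.IH] Cons.prems show ?case
      by (cases "y \<in> Poly_Mapping.keys f") simp_all
  qed
  have "mset (keys_list f) = mset (filter (\<lambda>x. x \<in> Poly_Mapping.keys f) xs)"
    using assms keys_list[of f] by (subst set_eq_iff_mset_eq_distinct[symmetric]) auto
  then have "mset (map ?g (keys_list f)) = mset (map ?g (filter (\<lambda>x. x \<in> Poly_Mapping.keys f) xs))"
    by simp
  moreover have "map ?g (keys_list f) \<in> lists ?E"
    using subset_trans[OF assms(3) assms(1)] keys_list(1)[of f]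
    by (auto intro!: single_in_free_space)
  ultimately have "fsum_eq ?E ?R (map ?g (keys_list f))
      (map ?g (filter (\<lambda>x. x \<in> Poly_Mapping.keys f) xs))"
    by (rule fsum_eq_permute)
  from fsum_eq.trans[OF this drop[OF assms(1)]] show ?thesis
    unfolding tensor_eq_def grouplike_comult_def by simp
qed

lemma grouplike_comult_add:
  assumes "f \<in> free_space X" "g \<in> free_space X"
  shows "tensor_eq_over free_scale (free_space X) (grouplike_comult (f + g))
    (grouplike_comult f @ grouplike_comult g)"
proof -
  let ?h = "\<lambda>f x. (Poly_Mapping.single x (Poly_Mapping.lookup f x), Poly_Mapping.single x (1::'b))"
  let ?E = "free_space X \<times> free_space X"
  let ?R = "tensor_rel (free_space X) (free_space X) (\<lambda>x c. free_scale c x) free_scale"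
  obtain xs where xs: "set xs = Poly_Mapping.keys f \<union> Poly_Mapping.keys g" "distinct xs"
    using finite_distinct_list[of "Poly_Mapping.keys f \<union> Poly_Mapping.keys g"] by auto
  have X: "set xs \<subseteq> X"
    using assms xs by (auto simp: free_space_def)
  have split: "fsum_eq ?E ?R (map (?h (f + g)) ys) (map (?h f) ys @ map (?h g) ys)"
    if "set ys \<subseteq> X" for ys
    using that
  proof (induction ys)
    case Nil
    show ?case by (simp add: fsum_eq.refl)
  next
    case (Cons y ys)
    have "([?h (f + g) y], [?h f y, ?h g y]) \<in> ?R"
      using Cons.prems unfolding tensor_rel_def
      by (auto simp: lookup_add single_add intro!: single_in_free_space)
    then have "fsum_eq ?E ?R ([?h (f + g) y] @ map (?h (f + g)) ys)
        ([?h f y, ?h g y] @ (map (?h f) ys @ map (?h g) ys))"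
      using Cons.prems by (intro fsum_eq.add[OF fsum_eq.rel Cons.IH]) auto
    moreover have "fsum_eq ?E ?R ([?h f y, ?h g y] @ (map (?h f) ys @ map (?h g) ys))
        (map (?h f) (y # ys) @ map (?h g) (y # ys))"
      using Cons.prems
      by (intro fsum_eq_permute) (auto intro!: single_in_free_space)
    ultimately have "fsum_eq ?E ?R ([?h (f + g) y] @ map (?h (f + g)) ys)
        (map (?h f) (y # ys) @ map (?h g) (y # ys))"
      by (rule fsum_eq.trans)
    then show ?case by simp
  qed
  note sup = grouplike_comult_superset[OF X xs(2), unfolded tensor_eq_def]
  have "Poly_Mapping.keys (f + g) \<subseteq> set xs"
    using keys_add[of f g] xs by auto
  then have "fsum_eq ?E ?R (grouplike_comult (f + g)) (map (?h f) xs @ map (?h g) xs)"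
    using fsum_eq.trans[OF sup split[OF X]] by simp
  moreover have "fsum_eq ?E ?R (grouplike_comult f @ grouplike_comult g)
      (map (?h f) xs @ map (?h g) xs)"
    using sup[of f] sup[of g] xs by (intro fsum_eq.add) auto
  ultimately show ?thesis
    unfolding tensor_eq_def by (rule fsum_eq.trans[OF _ fsum_eq.sym])
qed

lemma grouplike_comult_scale:
  assumes "f \<in> free_space X"
  shows "tensor_eq_over free_scale (free_space X) (grouplike_comult (free_scale c f))
    [(free_scale c x, y). (x, y) \<leftarrow> grouplike_comult f]"
proof -
  have eq: "[(free_scale c x, y). (x, y) \<leftarrow> grouplike_comult f] =
      [(Poly_Mapping.single x (Poly_Mapping.lookup (free_scale c f) x), Poly_Mapping.single x 1).
         x \<leftarrow> keys_list f]"
    unfolding grouplike_comult_def by (simp add: o_def free_scale_single lookup_free_scale)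
  show ?thesis
    unfolding eq
    by (rule grouplike_comult_superset)
      (use assms keys_free_scale[of c f] in \<open>auto simp: keys_list free_space_def\<close>)
qed

lemma grouplike_comult_sum_list:
  assumes "set fs \<subseteq> free_space X"
  shows "tensor_eq_over free_scale (free_space X) (grouplike_comult (sum_list fs))
    (concat (map grouplike_comult fs))"
  using assms
proof (induction fs)
  case Nil
  have "keys_list (0 :: 'a \<Rightarrow>\<^sub>0 'b) = []"
    using keys_list(1)[of "0 :: 'a \<Rightarrow>\<^sub>0 'b"] by simp
  then show ?case
    by (simp add: grouplike_comult_def tensor_eq_def fsum_eq.refl)
next
  case (Cons f fs)
  interpret vector_space "free_scale :: 'b \<Rightarrow> ('a \<Rightarrow>\<^sub>0 'b) \<Rightarrow> _" by (rule vector_space_free_scale)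
  have "sum_list fs \<in> free_space X" if "set fs \<subseteq> free_space X" for fs :: "('a \<Rightarrow>\<^sub>0 'b) list"
    using that
    by (induction fs) (auto simp: subspace_0 subspace_add subspace_free_space)
  then have "tensor_eq_over free_scale (free_space X) (grouplike_comult (f + sum_list fs))
      (grouplike_comult f @ grouplike_comult (sum_list fs))"
    using Cons.prems by (intro grouplike_comult_add) auto
  moreover have "tensor_eq_over free_scale (free_space X)
      (grouplike_comult f @ grouplike_comult (sum_list fs))
      (grouplike_comult f @ concat (map grouplike_comult fs))"
    using Cons grouplike_comult_closed[of f X] unfolding tensor_eq_def
    by (intro fsum_eq.add fsum_eq.refl) auto
  ultimately have "tensor_eq_over free_scale (free_space X) (grouplike_comult (f + sum_list fs))
      (grouplike_comult f @ concat (map grouplike_comult fs))"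
    unfolding tensor_eq_def by (rule fsum_eq.trans)
  then show ?case by simp
qed

lemma grouplike_comult_mult:
  assumes closed: "\<And>x y. x \<in> X \<Longrightarrow> y \<in> X \<Longrightarrow> m x y \<in> X"
    and "f \<in> free_space X" "g \<in> free_space X"
  shows "tensor_eq_over free_scale (free_space X) (grouplike_comult (free_mult m f g))
    (tensor_mult (free_mult m) (grouplike_comult f) (grouplike_comult g))"
proof -
  let ?p = "\<lambda>x y. Poly_Mapping.single (m x y) (Poly_Mapping.lookup f x * Poly_Mapping.lookup g y)"
  let ?fs = "[?p x y. x \<leftarrow> keys_list f, y \<leftarrow> keys_list g]"
  have "sum_list [?p x y. x \<leftarrow> xs, y \<leftarrow> ys] = (\<Sum>x\<leftarrow>xs. \<Sum>y\<leftarrow>ys. ?p x y)" for xs ys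
    by (induction xs) simp_all
  then have eq: "free_mult m f g = sum_list ?fs"
    unfolding free_mult_def by (simp add: sum_list_distinct_conv_sum_set keys_list)
  have "set ?fs \<subseteq> free_space X"
    using assms(2,3) unfolding free_space_def
    by (auto simp: keys_list split: if_splits dest: subsetD intro!: closed)
  moreover have "concat (map grouplike_comult ?fs) =
      tensor_mult (free_mult m) (grouplike_comult f) (grouplike_comult g)"
  proof -
    have inner: "concat (map grouplike_comult [?p x y. y \<leftarrow> ys]) =
        [(?p x y, Poly_Mapping.single (m x y) 1). y \<leftarrow> ys]"
      if "set ys \<subseteq> Poly_Mapping.keys g" "x \<in> Poly_Mapping.keys f" for x ys
      using that by (induction ys) (simp_all add: grouplike_comult_single in_keys_iff)
    have "concat (map grouplike_comult [?p x y. x \<leftarrow> xs, y \<leftarrow> keys_list g]) =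
        tensor_mult (free_mult m)
          [(Poly_Mapping.single x (Poly_Mapping.lookup f x), Poly_Mapping.single x 1). x \<leftarrow> xs]
          (grouplike_comult g)" if "set xs \<subseteq> Poly_Mapping.keys f" for xs
      using that inner
      unfolding tensor_mult_def grouplike_comult_def[of g]
      by (induction xs) (simp_all add: keys_list free_mult_single o_def)
    from this[of "keys_list f"] show ?thesis
      unfolding grouplike_comult_def[of f] by (simp add: keys_list)
  qed
  ultimately show ?thesis
    unfolding eq using grouplike_comult_sum_list[of ?fs X] by simp
qed

theorem (in inverse_semigroup_on) free_space_quantum_inverse_semigroup:
  "quantum_inverse_semigroup free_scale (free_space X :: ('x \<Rightarrow>\<^sub>0 'k::field) set) (free_mult m)
     grouplike_comult (free_map inv)"
proof -
  let ?Q = "free_space X :: ('x \<Rightarrow>\<^sub>0 'k) set"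
  interpret vector_space "free_scale :: 'k \<Rightarrow> ('x \<Rightarrow>\<^sub>0 'k) \<Rightarrow> _" by (rule vector_space_free_scale)
  show ?thesis
  proof unfold_locales
    fix p q r :: "'x \<Rightarrow>\<^sub>0 'k" and c :: 'k
    assume p: "p \<in> ?Q" and q: "q \<in> ?Q" and r: "r \<in> ?Q"
    show "free_mult m (free_mult m p q) r = free_mult m p (free_mult m q r)"
      using assoc p q r by (rule free_mult_assoc)
  next
    fix p q :: "'x \<Rightarrow>\<^sub>0 'k"
    assume p: "p \<in> ?Q" and q: "q \<in> ?Q"
    then show "free_map inv (free_mult m p q) = free_mult m (free_map inv q) (free_map inv p)"
    proof (induction p rule: free_space_induct)
      case p: (sum F a)
      from p(3) show ?case
      proof (induction q rule: free_space_induct)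
        case q: (sum G b)
        have "inv (m x y) = m (inv y) (inv x)" if "x \<in> F" "y \<in> G" for x y
          using that p q by (intro inv_mult) auto
        then show ?case
          by (simp add: free_mult_sum_left free_mult_sum_right free_mult_single free_map_sum
              free_map_single mult.commute sum.swap[of _ G])
      qed
    qed
    have projections: "(\<Sum>(x, y)\<leftarrow>grouplike_comult f. free_mult m x (free_map inv y)) =
        (\<Sum>x\<in>Poly_Mapping.keys f. Poly_Mapping.single (m x (inv x)) (Poly_Mapping.lookup f x))"
      "(\<Sum>(x, y)\<leftarrow>grouplike_comult f. free_mult m (free_map inv x) y) =
        (\<Sum>x\<in>Poly_Mapping.keys f. Poly_Mapping.single (m (inv x) x) (Poly_Mapping.lookup f x))"
      for f :: "'x \<Rightarrow>\<^sub>0 'k"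
      unfolding grouplike_comult_def
      by (simp_all add: o_def free_map_single free_mult_single sum_list_distinct_conv_sum_set
          keys_list)
    have "m (m x (inv x)) (m (inv y) y) = m (m (inv y) y) (m x (inv x))"
      if "x \<in> Poly_Mapping.keys p" "y \<in> Poly_Mapping.keys q" for x y
      using that p q by (intro projections_commute) (auto simp: free_space_def)
    then show "free_mult m (\<Sum>(x, y)\<leftarrow>grouplike_comult p. free_mult m x (free_map inv y))
          (\<Sum>(x, y)\<leftarrow>grouplike_comult q. free_mult m (free_map inv x) y) =
        free_mult m (\<Sum>(x, y)\<leftarrow>grouplike_comult q. free_mult m (free_map inv x) y)
          (\<Sum>(x, y)\<leftarrow>grouplike_comult p. free_mult m x (free_map inv y))"
      unfolding projections
      by (simp add: free_mult_sum_left free_mult_sum_right free_mult_single mult.commute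
          sum.swap[of _ "Poly_Mapping.keys q"])
  next
    fix q :: "'x \<Rightarrow>\<^sub>0 'k"
    assume q: "q \<in> ?Q"
    then have X: "x \<in> X" if "x \<in> Poly_Mapping.keys q" for x
      using that by (auto simp: free_space_def)
    show "(\<Sum>(x, y, z)\<leftarrow>map_left grouplike_comult (grouplike_comult q).
        free_mult m (free_mult m x (free_map inv y)) z) = q"
      unfolding map_left_grouplike_comult
      by (simp add: o_def free_map_single free_mult_single sum_list_distinct_conv_sum_set
          keys_list X regular sum_single_superset)
    show "(\<Sum>(x, y, z)\<leftarrow>map_left grouplike_comult (grouplike_comult q).
        free_mult m (free_mult m (free_map inv x) y) (free_map inv z)) = free_map inv q"
      unfolding map_left_grouplike_comult free_map_def[of inv q]
      by (simp add: o_def free_map_single free_mult_single sum_list_distinct_conv_sum_set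
          keys_list X inv_regular)
    show "tensor3_eq ?Q ?Q ?Q (\<lambda>x c. free_scale c x) free_scale (\<lambda>x c. free_scale c x) free_scale
        (map_left grouplike_comult (grouplike_comult q))
        (map_right grouplike_comult (grouplike_comult q))"
      unfolding map_left_grouplike_comult map_right_grouplike_comult tensor3_eq_def
      using X by (intro fsum_eq.refl) (auto simp: keys_list intro!: single_in_free_space)
  qed (auto simp: subspace_free_space free_mult_closed closed free_mult_add_left
      free_mult_add_right free_mult_scale_left free_mult_scale_right grouplike_comult_closed
      grouplike_comult_add grouplike_comult_scale grouplike_comult_mult free_map_closed[OF inv_closed]
      free_map_add free_map_scale simp del: in_lists_conv_set)
qed


section \<open>Partial inverses of local biretractions\<close>

text \<open>
  The two maps into the total algebra of a Hopf algebroid with \<open>s = s\<^sub>r = t\<^sub>l\<close> and \<open>t = s\<^sub>l = t\<^sub>r\<close>. Each of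
  them is a source map for one of the bialgebroids, hence multiplicative.
\<close>

locale base_maps =
  fixes s t :: "'a::{comm_ring, comm_monoid_mult} \<Rightarrow> 'h::{ring, monoid_mult}"
  assumes s_add: "s (a + b) = s a + s b"
    and s_mult: "s (a * b) = s a * s b"
    and s_one: "s 1 = 1"
    and t_add: "t (a + b) = t a + t b"
    and t_mult: "t (a * b) = t a * t b"
    and t_one: "t 1 = 1"

text \<open>
  A local biretraction together with its domain idempotent \<open>e\<close> and the inverse of the bijection
  \<open>\<alpha> \<circ> t : Ae \<rightarrow> A\<alpha>(1)\<close>. The latter is given as the map \<open>\<psi> : A \<rightarrow> Ae\<close> sending \<open>a\<close> to the preimage of
  \<open>a \<alpha>(1)\<close>; being defined on all of \<open>A\<close>, it turns bijectivity into equations.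
\<close>

locale local_biretraction = base_maps s t
  for s t :: "'a::{comm_ring, comm_monoid_mult} \<Rightarrow> 'h::{ring, monoid_mult}" +
  fixes \<alpha> :: "'h \<Rightarrow> 'a" and e :: 'a and \<psi> :: "'a \<Rightarrow> 'a"
  assumes add: "\<alpha> (x + y) = \<alpha> x + \<alpha> y"
    and mult: "\<alpha> (x * y) = \<alpha> x * \<alpha> y"
    and source: "\<alpha> (s a) = a * \<alpha> 1"
    and target_idem: "\<alpha> (t e) = \<alpha> 1"
    and \<psi>_range: "\<psi> a * e = \<psi> a"
    and target_\<psi>: "\<alpha> (t (\<psi> a)) = a * \<alpha> 1"
    and \<psi>_target: "\<psi> (\<alpha> (t a)) = a * e"
begin

lemma one_idem [simp]: "\<alpha> 1 * \<alpha> 1 = \<alpha> 1"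
  by (simp flip: mult)

lemma mult_one [simp]: "\<alpha> x * \<alpha> 1 = \<alpha> x" "\<alpha> 1 * \<alpha> x = \<alpha> x"
  by (simp_all flip: mult)

lemma source_mult: "\<alpha> (s a * x) = a * \<alpha> x" "\<alpha> (x * s a) = a * \<alpha> x"
  by (simp_all add: mult source mult.assoc mult.left_commute[of "\<alpha> x"])

lemma target_inj:
  assumes "\<alpha> (t a) = \<alpha> (t b)" "a * e = a" "b * e = b"
  shows "a = b"
  using assms \<psi>_target by metis

lemma \<psi>_eqI: "\<alpha> (t b) = a * \<alpha> 1 \<Longrightarrow> b * e = b \<Longrightarrow> \<psi> a = b"
  by (rule target_inj) (simp_all add: target_\<psi> \<psi>_range)

lemma e_idem [simp]: "e * e = e"
  using \<psi>_range[of "\<alpha> (t 1)"] \<psi>_target[of 1] by simp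

lemma \<psi>_add: "\<psi> (a + b) = \<psi> a + \<psi> b"
  by (rule \<psi>_eqI) (simp_all add: t_add add target_\<psi> distrib_right \<psi>_range)

lemma \<psi>_mult: "\<psi> (a * b) = \<psi> a * \<psi> b"
proof (rule \<psi>_eqI)
  show "\<alpha> (t (\<psi> a * \<psi> b)) = a * b * \<alpha> 1"
    by (simp add: t_mult mult target_\<psi> ac_simps)
qed (simp add: mult.assoc \<psi>_range)

lemma \<psi>_one: "\<psi> (\<alpha> 1) = e"
  by (rule \<psi>_eqI) (simp_all add: target_idem)

lemma \<psi>_mult_one: "\<psi> (a * \<alpha> 1) = \<psi> a"
  by (simp add: \<psi>_mult \<psi>_one \<psi>_range)

end

abbreviation (in base_maps) brt where "brt \<equiv> local_biretraction s t"

text \<open>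
  The bijectivity in the definition of local biretractions, expressed by an inverse \<open>\<psi>\<close> defined on
  all of \<open>A\<close>. That \<open>e\<close> is idempotent follows in each direction: for a bijection because \<open>e\<close> and
  \<open>e * e\<close> have the same image \<open>q\<close>, and from \<open>\<psi>\<close> because \<open>e = \<psi> (f 1)\<close>.
\<close>

lemma bij_betw_ideal_iff:
  fixes f :: "'a::{comm_ring, comm_monoid_mult} \<Rightarrow> 'a"
  assumes mult: "\<And>a b. f (a * b) = f a * f b" and idem: "q * q = q" and e: "f e = q"
    and one: "\<And>a. f a * q = f a"
  shows "bij_betw f (range (\<lambda>a. a * e)) (range (\<lambda>a. a * q)) \<longleftrightarrow>
    (\<exists>\<psi>. (\<forall>a. \<psi> a * e = \<psi> a) \<and> (\<forall>a. f (\<psi> a) = a * q) \<and> (\<forall>a. \<psi> (f a) = a * e))"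
    (is "?bij \<longleftrightarrow> ?inv")
proof
  assume bij: ?bij
  have "e * e = e"
  proof -
    have "f (e * e) = f e"
      by (simp add: mult e idem)
    moreover have "e * e \<in> range (\<lambda>a. a * e)" "e \<in> range (\<lambda>a. a * e)"
      using rangeI[of "\<lambda>a. a * e" 1] by auto
    ultimately show ?thesis
      using bij unfolding bij_betw_def by (blast dest: inj_onD)
  qed
  then have ideal: "x * e = x" if "x \<in> range (\<lambda>a. a * e)" for x
    using that by (auto simp: mult.assoc)
  define \<psi> where "\<psi> a = inv_into (range (\<lambda>a. a * e)) f (a * q)" for a
  have range: "\<psi> a \<in> range (\<lambda>a. a * e)" for a
    unfolding \<psi>_def using bij by (intro inv_into_into) (auto simp: bij_betw_def)
  have "f (\<psi> a) = a * q" for a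
    unfolding \<psi>_def using bij by (intro f_inv_into_f) (auto simp: bij_betw_def)
  moreover have "\<psi> (f a) = a * e" for a
  proof -
    have "\<psi> (f a) = inv_into (range (\<lambda>a. a * e)) f (f (a * e))"
      unfolding \<psi>_def by (simp add: one mult e)
    then show ?thesis
      using bij by (simp add: bij_betw_def inv_into_f_f)
  qed
  ultimately show ?inv
    using ideal[OF range] by blast
next
  assume ?inv
  then obtain \<psi> where \<psi>: "\<And>a. \<psi> a * e = \<psi> a" "\<And>a. f (\<psi> a) = a * q" "\<And>a. \<psi> (f a) = a * e"
    by blast
  have "e * e = e"
    using \<psi>(1)[of "f 1"] \<psi>(3)[of 1] by simp
  show ?bij
  proof (rule bij_betw_byWitness[where f' = \<psi>])
    show "\<forall>a\<in>range (\<lambda>a. a * e). \<psi> (f a) = a"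
      by (auto simp: \<psi>(3) mult.assoc \<open>e * e = e\<close>)
    show "\<forall>a\<in>range (\<lambda>a. a * q). f (\<psi> a) = a"
      by (auto simp: \<psi>(2) mult.assoc idem)
    show "f ` range (\<lambda>a. a * e) \<subseteq> range (\<lambda>a. a * q)"
      by (auto simp: mult e)
    show "\<psi> ` range (\<lambda>a. a * q) \<subseteq> range (\<lambda>a. a * e)"
      using \<psi>(1) by (metis image_subsetI rangeI)
  qed
qed


section \<open>Convolution\<close>

definition biadditive :: "('m::ab_group_add \<Rightarrow> 'n::ab_group_add \<Rightarrow> 'c::ab_group_add) \<Rightarrow> bool"
  where "biadditive f \<longleftrightarrow>
    (\<forall>x x' y. f (x + x') y = f x y + f x' y) \<and> (\<forall>x y y'. f x (y + y') = f x y + f x y')"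

text \<open>
  These maps factor both through the tensor product on which \<open>\<Delta>\<^sub>l\<close> takes its values and through that of
  \<open>\<Delta>\<^sub>r\<close>. Because \<open>A\<close> is commutative and local biretractions are multiplicative, the summands of a
  convolution are of this kind.
\<close>

definition bibalanced ::
  "('a \<Rightarrow> 'h) \<Rightarrow> ('a \<Rightarrow> 'h) \<Rightarrow> ('h::ring \<Rightarrow> 'h \<Rightarrow> 'c::ab_group_add) \<Rightarrow> bool"
  where "bibalanced s t f \<longleftrightarrow> biadditive f \<and>
    (\<forall>x a y. f (s a * x) y = f x (t a * y)) \<and> (\<forall>x a y. f (x * s a) y = f x (y * t a))"

text \<open>
  What \<open>\<Delta>\<^sub>l\<close> and \<open>\<Delta>\<^sub>r\<close> have in common when they are tested on bibalanced maps. This makes it possible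
  to treat the two convolutions at the same time.
\<close>

locale algebra_comult = base_maps s t
  for s t :: "'a::{comm_ring, comm_monoid_mult} \<Rightarrow> 'h::{ring, monoid_mult}" +
  fixes D :: "'h \<Rightarrow> ('h \<times> 'h) list"
  assumes comult_add: "bibalanced s t f \<Longrightarrow>
      (\<Sum>(x, y)\<leftarrow>D (h + k). f x y) = (\<Sum>(x, y)\<leftarrow>D h @ D k. (f x y :: 'a))"
    and comult_mult: "bibalanced s t f \<Longrightarrow>
      (\<Sum>(x, y)\<leftarrow>D (h * k). f x y) = (\<Sum>(x, y)\<leftarrow>tensor_mult (*) (D h) (D k). (f x y :: 'a))"
    and comult_s: "bibalanced s t f \<Longrightarrow> (\<Sum>(x, y)\<leftarrow>D (s a). f x y) = (f 1 (s a) :: 'a)"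
    and comult_t: "bibalanced s t f \<Longrightarrow> (\<Sum>(x, y)\<leftarrow>D (t a). f x y) = (f (t a) 1 :: 'a)"

lemma sum_list_additive:
  fixes g :: "'a::ab_group_add \<Rightarrow> 'b::ab_group_add"
  assumes "\<And>x y. g (x + y) = g x + g y"
  shows "g (\<Sum>(x, y)\<leftarrow>us. f x y) = (\<Sum>(x, y)\<leftarrow>us. g (f x y))"
proof -
  have "g 0 = 0" using assms[of 0 0] by simp
  then show ?thesis
    by (induction us) (auto simp: assms)
qed

lemma sum_list_pair_cong:
  "(\<And>x y. (x, y) \<in> set us \<Longrightarrow> f x y = g x y) \<Longrightarrow> (\<Sum>(x, y)\<leftarrow>us. f x y) = (\<Sum>(x, y)\<leftarrow>us. g x y)"
  by (intro arg_cong[where f = sum_list] map_cong) auto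

lemma sum_list_pair_swap:
  fixes f :: "'x \<Rightarrow> 'y \<Rightarrow> 'x' \<Rightarrow> 'y' \<Rightarrow> 'a::comm_monoid_add"
  shows "(\<Sum>(x, y)\<leftarrow>us. \<Sum>(x', y')\<leftarrow>vs. f x y x' y') = (\<Sum>(x', y')\<leftarrow>vs. \<Sum>(x, y)\<leftarrow>us. f x y x' y')"
  by (induction us) (auto simp: case_prod_unfold sum_list_addf)

lemma sum_list_pair_mult:
  fixes f g :: "'x \<Rightarrow> 'y \<Rightarrow> 'a::comm_ring"
  shows "(\<Sum>(x, y)\<leftarrow>us. f x y) * (\<Sum>(x', y')\<leftarrow>vs. g x' y') =
    (\<Sum>(x, y)\<leftarrow>us. \<Sum>(x', y')\<leftarrow>vs. f x y * g x' y')"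
  by (induction us) (auto simp: distrib_right case_prod_unfold sum_list_const_mult)

context algebra_comult
begin

abbreviation conv where "conv \<equiv> convolution t D"

lemma bibalanced_convolution:
  assumes "brt \<alpha> e \<psi>" "brt \<beta> f \<chi>"
  shows "bibalanced s t (\<lambda>x y. \<beta> (t (\<alpha> x)) * \<beta> y)"
proof -
  interpret a: local_biretraction s t \<alpha> e \<psi> by fact
  interpret b: local_biretraction s t \<beta> f \<chi> by fact
  show ?thesis
    unfolding bibalanced_def biadditive_def
    by (simp add: a.add b.add t_add t_mult b.mult a.source_mult distrib_left distrib_right ac_simps)
qed

lemma convolution_target:
  assumes "brt \<alpha> e \<psi>" "brt \<beta> f \<chi>"
  shows "conv \<alpha> \<beta> (t a) = \<beta> (t (\<alpha> (t a)))"
proof -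
  interpret b: local_biretraction s t \<beta> f \<chi> by fact
  show ?thesis
    using comult_t[OF bibalanced_convolution[OF assms]] unfolding convolution_def by simp
qed

text \<open>
  On the image of \<open>t\<close> the convolution is the composition of the partial isomorphisms
  \<open>\<alpha> \<circ> t\<close> and \<open>\<beta> \<circ> t\<close>, so its inverse is \<open>\<psi> \<circ> \<chi>\<close> and its domain is the preimage of \<open>f\<close>.
\<close>

lemma convolution_brt:
  assumes "brt \<alpha> e \<psi>" "brt \<beta> f \<chi>"
  shows "brt (conv \<alpha> \<beta>) (\<psi> f) (\<psi> \<circ> \<chi>)"
proof -
  interpret a: local_biretraction s t \<alpha> e \<psi> by fact
  interpret b: local_biretraction s t \<beta> f \<chi> by fact
  note bal = bibalanced_convolution[OF assms]
  note target = convolution_target[OF assms]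
  have one: "conv \<alpha> \<beta> 1 = \<beta> (t (\<alpha> 1))"
    using target[of 1] by (simp add: t_one)
  show ?thesis
  proof
    show "conv \<alpha> \<beta> (x + y) = conv \<alpha> \<beta> x + conv \<alpha> \<beta> y" for x y
      using comult_add[OF bal] unfolding convolution_def by simp
    show "conv \<alpha> \<beta> (x * y) = conv \<alpha> \<beta> x * conv \<alpha> \<beta> y" for x y
      unfolding convolution_def comult_mult[OF bal] sum_list_tensor_mult sum_list_pair_mult
      by (simp add: a.mult b.mult t_mult ac_simps)
    show "conv \<alpha> \<beta> (s a) = a * conv \<alpha> \<beta> 1" for a
      unfolding one unfolding convolution_def
      using comult_s[OF bal] by (simp add: b.source mult.left_commute)
    show "conv \<alpha> \<beta> (t (\<psi> f)) = conv \<alpha> \<beta> 1"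
      unfolding target one by (simp add: a.target_\<psi> t_mult b.mult b.target_idem)
    show "(\<psi> \<circ> \<chi>) a * \<psi> f = (\<psi> \<circ> \<chi>) a" for a
      by (simp add: b.\<psi>_range flip: a.\<psi>_mult)
    show "conv \<alpha> \<beta> (t ((\<psi> \<circ> \<chi>) a)) = a * conv \<alpha> \<beta> 1" for a
      unfolding target one by (simp add: a.target_\<psi> t_mult b.mult b.target_\<psi> mult.assoc)
    show "(\<psi> \<circ> \<chi>) (conv \<alpha> \<beta> (t a)) = a * \<psi> f" for a
      unfolding target
      by (simp add: b.\<psi>_target a.\<psi>_mult a.\<psi>_target mult.assoc)
         (metis a.\<psi>_range mult.commute)
  qed
qed

end

text \<open>
  Stated for two comultiplications, so that it yields the associativity of \<open>*\<^sub>l\<close> and both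
  mixed associativities.
\<close>

lemma convolution_assoc:
  fixes s t :: "'a::{comm_ring, comm_monoid_mult} \<Rightarrow> 'h::{ring, monoid_mult}"
  assumes D1: "algebra_comult s t D1" and D2: "algebra_comult s t D2"
    and coassoc: "\<And>f :: 'h \<Rightarrow> 'h \<Rightarrow> 'h \<Rightarrow> 'a.
      (\<And>z. bibalanced s t (\<lambda>x y. f x y z)) \<Longrightarrow> (\<And>x. bibalanced s t (f x)) \<Longrightarrow>
      (\<Sum>(x, y, z)\<leftarrow>map_left D1 (D2 h). f x y z) = (\<Sum>(x, y, z)\<leftarrow>map_right D2 (D1 h). f x y z)"
    and \<alpha>: "local_biretraction s t \<alpha> e \<psi>" and \<beta>: "local_biretraction s t \<beta> f \<chi>"
    and \<gamma>: "local_biretraction s t \<gamma> g \<omega>"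
  shows "convolution t D2 (convolution t D1 \<alpha> \<beta>) \<gamma> h = convolution t D1 \<alpha> (convolution t D2 \<beta> \<gamma>) h"
proof -
  interpret D2: algebra_comult s t D2 by fact
  interpret a: local_biretraction s t \<alpha> e \<psi> by fact
  interpret b: local_biretraction s t \<beta> f \<chi> by fact
  interpret c: local_biretraction s t \<gamma> g \<omega> by fact
  let ?f = "\<lambda>x y z. \<gamma> (t (\<beta> (t (\<alpha> x)))) * \<gamma> (t (\<beta> y)) * \<gamma> z"
  have "convolution t D2 (convolution t D1 \<alpha> \<beta>) \<gamma> h = (\<Sum>(x, y, z)\<leftarrow>map_left D1 (D2 h). ?f x y z)"
    unfolding convolution_def sum_list_map_left
    by (simp add: sum_list_additive[where g = "\<lambda>x. \<gamma> (t x) * _"] D2.t_add c.add distrib_right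
        D2.t_mult c.mult)
  also have "\<dots> = (\<Sum>(x, y, z)\<leftarrow>map_right D2 (D1 h). ?f x y z)"
  proof (rule coassoc)
    show "bibalanced s t (\<lambda>x y. ?f x y z)" for z
      unfolding bibalanced_def biadditive_def
      by (simp add: a.add b.add c.add D2.t_add D2.t_mult b.mult c.mult a.source_mult
          distrib_left distrib_right ac_simps)
    show "bibalanced s t (?f x)" for x
      unfolding bibalanced_def biadditive_def
      by (simp add: b.add c.add D2.t_add D2.t_mult c.mult b.source_mult
          distrib_left distrib_right ac_simps)
  qed
  also have "\<dots> = (\<Sum>(x, y)\<leftarrow>D1 h. \<gamma> (t (\<beta> (t (\<alpha> x)))) * convolution t D2 \<beta> \<gamma> y)"
    unfolding convolution_def sum_list_map_right
    by (simp add: sum_list_additive[where g = "\<lambda>x. _ * x"] distrib_left mult.assoc)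
  also have "\<dots> = convolution t D1 \<alpha> (convolution t D2 \<beta> \<gamma>) h"
    unfolding convolution_def[of t D1] D2.convolution_target[OF \<beta> \<gamma>] ..
  finally show ?thesis .
qed


section \<open>Hopf algebroids with matching base maps\<close>

locale biretractable_hopf_algebroid = hopf_algebroid scaleA scaleH t s Dl el s t Dr er S
  for scaleA :: "'k::field \<Rightarrow> 'a::{comm_ring, comm_monoid_mult} \<Rightarrow> 'a"
    and scaleH :: "'k \<Rightarrow> 'h::{ring, monoid_mult} \<Rightarrow> 'h"
    and s t :: "'a \<Rightarrow> 'h"
    and Dl :: "'h \<Rightarrow> ('h \<times> 'h) list" and el :: "'h \<Rightarrow> 'a"
    and Dr :: "'h \<Rightarrow> ('h \<times> 'h) list" and er :: "'h \<Rightarrow> 'a"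
    and S :: "'h \<Rightarrow> 'h"
begin

sublocale base_maps s t
proof
  interpret ls: algebra_morphism scaleA scaleH t
    using left left_bialgebroid.source by blast
  interpret rs: algebra_morphism scaleA scaleH s
    using right right_bialgebroid.source by blast
  show "t (a + b) = t a + t b" "t (a * b) = t a * t b" "t 1 = 1" for a b
    using ls.linear ls.mult ls.one by (auto simp: Vector_Spaces.linear_iff)
  show "s (a + b) = s a + s b" "s (a * b) = s a * s b" "s 1 = 1" for a b
    using rs.linear rs.mult rs.one by (auto simp: Vector_Spaces.linear_iff)
qed

lemma left_coring: "coring (left_lact t) (left_ract s) Dl el"
  using left by (rule left_bialgebroid.coring)

lemma right_coring: "coring (right_lact t) (right_ract s) Dr er"
  using right by (rule right_bialgebroid.coring)

lemma commute: "s a * t b = t b * s a"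
  using right by (rule right_bialgebroid.source_target_commute)

lemma sum_left_eq:
  assumes "tensor_eq UNIV UNIV (left_ract s) (left_lact t) us vs"
    and "biadditive f" "\<And>x a y. f (s a * x) y = f x (t a * y)"
  shows "(\<Sum>(x, y)\<leftarrow>us. f x y) = (\<Sum>(x, y)\<leftarrow>vs. f x y)"
  using assms(2,3) unfolding biadditive_def
  by (intro tensor_eq_sum_list[OF assms(1)]) (auto simp: left_ract_def left_lact_def)

lemma sum_right_eq:
  assumes "tensor_eq UNIV UNIV (right_ract s) (right_lact t) us vs"
    and "biadditive f" "\<And>x a y. f (x * s a) y = f x (y * t a)"
  shows "(\<Sum>(x, y)\<leftarrow>us. f x y) = (\<Sum>(x, y)\<leftarrow>vs. f x y)"
  using assms(2,3) unfolding biadditive_def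
  by (intro tensor_eq_sum_list[OF assms(1)]) (auto simp: right_ract_def right_lact_def)

sublocale dl: algebra_comult s t Dl
proof
  fix f :: "'h \<Rightarrow> 'h \<Rightarrow> 'a" and h k a
  assume "bibalanced s t f"
  then have f: "biadditive f" "\<And>x a y. f (s a * x) y = f x (t a * y)"
    unfolding bibalanced_def by auto
  note eq = sum_left_eq[OF _ f]
  show "(\<Sum>(x, y)\<leftarrow>Dl (h + k). f x y) = (\<Sum>(x, y)\<leftarrow>Dl h @ Dl k. f x y)"
    by (rule eq[OF coring.comult_add[OF left_coring]])
  show "(\<Sum>(x, y)\<leftarrow>Dl (h * k). f x y) = (\<Sum>(x, y)\<leftarrow>tensor_mult (*) (Dl h) (Dl k). f x y)"
    by (rule eq[OF left_bialgebroid.comult_mult[OF left]])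
  have f_s: "biadditive (\<lambda>x y. f x (s a * y))" "\<And>x b y. f (s b * x) (s a * y) = f x (s a * (t b * y))"
    using f(1) unfolding biadditive_def
    by (simp_all add: distrib_left f(2)) (simp add: commute flip: mult.assoc)
  have "(\<Sum>(x, y)\<leftarrow>Dl (s a). f x y) = (\<Sum>(x, y)\<leftarrow>Dl 1. f x (s a * y))"
    using eq[OF coring.comult_ract[OF left_coring, of 1 a]]
    by (simp add: left_ract_def o_def case_prod_unfold)
  also have "\<dots> = f 1 (s a)"
    using sum_left_eq[OF left_bialgebroid.comult_one[OF left] f_s] by simp
  finally show "(\<Sum>(x, y)\<leftarrow>Dl (s a). f x y) = f 1 (s a)" .
  have f_t: "biadditive (\<lambda>x y. f (t a * x) y)" "\<And>x b y. f (t a * (s b * x)) y = f (t a * x) (t b * y)"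
    using f(1) unfolding biadditive_def
    by (simp_all add: distrib_left) (metis f(2) commute mult.assoc)
  have "(\<Sum>(x, y)\<leftarrow>Dl (t a). f x y) = (\<Sum>(x, y)\<leftarrow>Dl 1. f (t a * x) y)"
    using eq[OF coring.comult_lact[OF left_coring, of a 1]]
    by (simp add: left_lact_def o_def case_prod_unfold)
  also have "\<dots> = f (t a) 1"
    using sum_left_eq[OF left_bialgebroid.comult_one[OF left] f_t] by simp
  finally show "(\<Sum>(x, y)\<leftarrow>Dl (t a). f x y) = f (t a) 1" .
qed

sublocale dr: algebra_comult s t Dr
proof
  fix f :: "'h \<Rightarrow> 'h \<Rightarrow> 'a" and h k a
  assume "bibalanced s t f"
  then have f: "biadditive f" "\<And>x a y. f (x * s a) y = f x (y * t a)"
    unfolding bibalanced_def by auto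
  note eq = sum_right_eq[OF _ f]
  show "(\<Sum>(x, y)\<leftarrow>Dr (h + k). f x y) = (\<Sum>(x, y)\<leftarrow>Dr h @ Dr k. f x y)"
    by (rule eq[OF coring.comult_add[OF right_coring]])
  show "(\<Sum>(x, y)\<leftarrow>Dr (h * k). f x y) = (\<Sum>(x, y)\<leftarrow>tensor_mult (*) (Dr h) (Dr k). f x y)"
    by (rule eq[OF right_bialgebroid.comult_mult[OF right]])
  have f_s: "biadditive (\<lambda>x y. f x (y * s a))" "\<And>x b y. f (x * s b) (y * s a) = f x (y * t b * s a)"
    using f(1) unfolding biadditive_def
    by (simp_all add: distrib_right f(2)) (simp add: commute mult.assoc)
  have "(\<Sum>(x, y)\<leftarrow>Dr (s a). f x y) = (\<Sum>(x, y)\<leftarrow>Dr 1. f x (y * s a))"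
    using eq[OF coring.comult_ract[OF right_coring, of 1 a]]
    by (simp add: right_ract_def o_def case_prod_unfold)
  also have "\<dots> = f 1 (s a)"
    using sum_right_eq[OF right_bialgebroid.comult_one[OF right] f_s] by simp
  finally show "(\<Sum>(x, y)\<leftarrow>Dr (s a). f x y) = f 1 (s a)" .
  have f_t: "biadditive (\<lambda>x y. f (x * t a) y)" "\<And>x b y. f (x * s b * t a) y = f (x * t a) (y * t b)"
    using f(1) unfolding biadditive_def
    by (simp_all add: distrib_right) (metis f(2) commute mult.assoc)
  have "(\<Sum>(x, y)\<leftarrow>Dr (t a). f x y) = (\<Sum>(x, y)\<leftarrow>Dr 1. f (x * t a) y)"
    using eq[OF coring.comult_lact[OF right_coring, of a 1]]
    by (simp add: right_lact_def o_def case_prod_unfold)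
  also have "\<dots> = f (t a) 1"
    using sum_right_eq[OF right_bialgebroid.comult_one[OF right] f_t] by simp
  finally show "(\<Sum>(x, y)\<leftarrow>Dr (t a). f x y) = f (t a) 1" .
qed

lemma coassoc_bibalanced:
  fixes f :: "'h \<Rightarrow> 'h \<Rightarrow> 'h \<Rightarrow> 'c::ab_group_add"
  assumes "\<And>z. bibalanced s t (\<lambda>x y. f x y z)" "\<And>x. bibalanced s t (f x)"
  shows coassoc_left_left_bibalanced:
      "(\<Sum>(x, y, z)\<leftarrow>map_left Dl (Dl h). f x y z) = (\<Sum>(x, y, z)\<leftarrow>map_right Dl (Dl h). f x y z)"
    and coassoc_left_right_bibalanced:
      "(\<Sum>(x, y, z)\<leftarrow>map_left Dl (Dr h). f x y z) = (\<Sum>(x, y, z)\<leftarrow>map_right Dr (Dl h). f x y z)"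
    and coassoc_right_left_bibalanced:
      "(\<Sum>(x, y, z)\<leftarrow>map_left Dr (Dl h). f x y z) = (\<Sum>(x, y, z)\<leftarrow>map_right Dl (Dr h). f x y z)"
  using assms unfolding bibalanced_def biadditive_def
  by (intro tensor3_eq_sum_list[OF coring.coassoc[OF left_coring]]
      tensor3_eq_sum_list[OF coassoc_left_right] tensor3_eq_sum_list[OF coassoc_right_left];
      simp add: left_ract_def left_lact_def right_ract_def right_lact_def)+


section \<open>Local biretractions and the antipode\<close>

text \<open>
  The field acts through \<open>A\<close>, so linearity over the field follows from linearity over \<open>A\<close>.
\<close>

lemma scaleH_eq: "scaleH c h = s (scaleA c 1) * h"
proof -
  interpret H: unital_algebra scaleH
    using right by (rule right_bialgebroid.total_algebra)
  have "s (scaleA c 1) = scaleH c (s 1)"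
    using algebra_morphism.linear[OF right_bialgebroid.source[OF right]]
    by (simp add: Vector_Spaces.linear_iff)
  then show ?thesis
    by (simp add: s_one H.scale_mult_left)
qed

lemma Brt_iff: "\<alpha> \<in> Brt scaleA scaleH s t \<longleftrightarrow> (\<exists>e \<psi>. brt \<alpha> e \<psi>)"
proof
  assume "\<alpha> \<in> Brt scaleA scaleH s t"
  then obtain e where lin: "Vector_Spaces.linear scaleH scaleA \<alpha>"
    and mult: "\<And>h k. \<alpha> (h * k) = \<alpha> h * \<alpha> k" and source: "\<And>a. \<alpha> (s a) = a * \<alpha> 1"
    and e: "\<alpha> (t e) = \<alpha> 1"
    and bij: "bij_betw (\<lambda>x. \<alpha> (t x)) (range (\<lambda>a. a * e)) (range (\<lambda>a. a * \<alpha> 1))"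
    unfolding Brt_def by blast
  have one: "\<alpha> x * \<alpha> 1 = \<alpha> x" for x
    by (simp flip: mult)
  from bij obtain \<psi> where "\<forall>a. \<psi> a * e = \<psi> a" "\<forall>a. \<alpha> (t (\<psi> a)) = a * \<alpha> 1"
    "\<forall>a. \<psi> (\<alpha> (t a)) = a * e"
    by (subst (asm) bij_betw_ideal_iff) (auto simp: e t_mult mult one)
  then have "brt \<alpha> e \<psi>"
    using lin mult source e by unfold_locales (auto simp: Vector_Spaces.linear_iff)
  then show "\<exists>e \<psi>. brt \<alpha> e \<psi>" by blast
next
  assume "\<exists>e \<psi>. brt \<alpha> e \<psi>"
  then obtain e \<psi> where "brt \<alpha> e \<psi>" by blast
  then interpret a: local_biretraction s t \<alpha> e \<psi> .
  interpret A: unital_algebra scaleA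
    using right by (rule right_bialgebroid.base_algebra)
  interpret H: unital_algebra scaleH
    using right by (rule right_bialgebroid.total_algebra)
  have "\<alpha> (scaleH c h) = scaleA c (\<alpha> h)" for c h
    by (simp add: scaleH_eq a.source_mult A.scale_mult_left)
  then have "Vector_Spaces.linear scaleH scaleA \<alpha>"
    by (simp add: Vector_Spaces.linear_iff a.add A.vector_space_axioms H.vector_space_axioms)
  moreover have "bij_betw (\<lambda>x. \<alpha> (t x)) (range (\<lambda>a. a * e)) (range (\<lambda>a. a * \<alpha> 1))"
    using a.\<psi>_range a.target_\<psi> a.\<psi>_target
    by (subst bij_betw_ideal_iff) (auto simp: t_mult a.mult a.target_idem)
  ultimately show "\<alpha> \<in> Brt scaleA scaleH s t"
    unfolding Brt_def using a.mult a.source a.target_idem by blast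
qed

lemma counits_additive: "el (x + y) = el x + el y" "er (x + y) = er x + er y"
  using coring.counit_add[OF left_coring] coring.counit_add[OF right_coring] by auto

lemma el_base: "el (t a * x) = a * el x" "el (s a * x) = a * el x"
  using coring.counit_lact[OF left_coring, of a x] coring.counit_ract[OF left_coring, of x a]
  by (simp_all add: left_lact_def left_ract_def mult.commute)

lemma er_base: "er (x * t a) = a * er x" "er (x * s a) = a * er x"
  using coring.counit_lact[OF right_coring, of a x] coring.counit_ract[OF right_coring, of x a]
  by (simp_all add: right_lact_def right_ract_def mult.commute)

lemma left_counit:
  "(\<Sum>(x, y)\<leftarrow>Dl h. t (el x) * y) = h" "(\<Sum>(x, y)\<leftarrow>Dl h. s (el y) * x) = h"
  using coring.counit_left[OF left_coring, of h] coring.counit_right[OF left_coring, of h]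
  by (simp_all add: left_lact_def left_ract_def)

lemma right_counit:
  "(\<Sum>(x, y)\<leftarrow>Dr h. y * t (er x)) = h" "(\<Sum>(x, y)\<leftarrow>Dr h. x * s (er y)) = h"
  using coring.counit_left[OF right_coring, of h] coring.counit_right[OF right_coring, of h]
  by (simp_all add: right_lact_def right_ract_def)

text \<open>
  The counits need not send \<open>1\<close> to \<open>1\<close>: they vanish if \<open>H\<close> is the zero algebra. This is harmless,
  because the base maps, and hence local biretractions, do not see the difference.
\<close>

lemma t_el_one: "t (el 1) = 1"
  using sl_el_tr[of 1] by (simp add: t_one)

lemma s_el_one: "s (el 1) = 1"
  using tl_el_sr[of 1] by (simp add: s_one)

lemma s_er_one: "s (er 1) = 1"
  using sr_er_tl[of 1] by (simp add: s_one)

lemma S_add: "S (x + y) = S x + S y"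
  using antipode_linear by (simp add: Vector_Spaces.linear_iff)

lemma S_base: "S (s a * x) = S x * t a" "S (x * t a) = s a * S x"
  using antipode_bimodule[of a x 1] antipode_bimodule[of 1 x a] by (simp_all add: s_one t_one)

lemma S_one: "S 1 = 1"
proof -
  have "(\<Sum>(x, y)\<leftarrow>Dl 1. S x * y) = (\<Sum>(x, y)\<leftarrow>[(1, 1)]. S x * y)"
    using left_bialgebroid.comult_one[OF left]
    by (rule sum_left_eq)
      (simp_all add: biadditive_def S_add S_base distrib_left distrib_right mult.assoc)
  then show ?thesis
    by (simp add: antipode_left s_er_one)
qed

lemma S_images: "S (s a) = t a" "S (t a) = s a"
  using S_base(1)[of a 1] S_base(2)[of 1 a] by (simp_all add: S_one)

text \<open>
  \<open>\<epsilon>\<^sub>l q\<close>, the identity over \<open>q\<close>. It is a local biretraction only for suitable \<open>q\<close>, since \<open>\<epsilon>\<^sub>l\<close> itself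
  need not be multiplicative.
\<close>

definition unit :: "'a \<Rightarrow> 'h \<Rightarrow> 'a"
  where "unit q h = el h * q"

context
  fixes \<alpha> e \<psi>
  assumes \<alpha>: "brt \<alpha> e \<psi>"
begin

interpretation a: local_biretraction s t \<alpha> e \<psi> by (fact \<alpha>)

lemma antipode_left_brt: "(\<Sum>(x, y)\<leftarrow>Dl h. \<alpha> (S x) * \<alpha> y) = er h * \<alpha> 1"
proof -
  have "(\<Sum>(x, y)\<leftarrow>Dl h. \<alpha> (S x) * \<alpha> y) = \<alpha> (\<Sum>(x, y)\<leftarrow>Dl h. S x * y)"
    by (simp add: sum_list_additive[where g = \<alpha>, OF a.add] a.mult)
  then show ?thesis
    by (simp add: antipode_left a.source)
qed

lemma antipode_right_brt: "(\<Sum>(x, y)\<leftarrow>Dr h. \<alpha> x * \<alpha> (S y)) = \<alpha> (t (el h))"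
proof -
  have "(\<Sum>(x, y)\<leftarrow>Dr h. \<alpha> x * \<alpha> (S y)) = \<alpha> (\<Sum>(x, y)\<leftarrow>Dr h. x * S y)"
    by (simp add: sum_list_additive[where g = \<alpha>, OF a.add] a.mult)
  then show ?thesis
    by (simp add: antipode_right)
qed

lemma antipode_base_brt: "\<alpha> (S (s a * x)) = \<alpha> (t a) * \<alpha> (S x)" "\<alpha> (S (x * t a)) = a * \<alpha> (S x)"
  by (simp_all add: S_base a.source_mult) (simp add: a.mult mult.commute)

text \<open>
  As \<open>\<epsilon>\<^sub>r(hk) = \<epsilon>\<^sub>r(s(\<epsilon>\<^sub>r(h)) k)\<close>, only factors of the form \<open>s(a)\<close> have to be taken out. In
  \<open>\<alpha>(S(x) y)\<close> a factor \<open>s(a)\<close> between \<open>S(x)\<close> and \<open>y\<close> comes out as \<open>a\<close>, because \<open>\<alpha>\<close> is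
  multiplicative with commutative values.
\<close>

lemma er_mult_brt: "er (h * k) * \<alpha> 1 = er h * er k * \<alpha> 1"
proof -
  have "er (s a * k) * \<alpha> 1 = a * er k * \<alpha> 1" for a
  proof -
    have "(\<Sum>(x, y)\<leftarrow>Dl (s a * k). \<alpha> (S x) * \<alpha> y) =
        (\<Sum>(x, y)\<leftarrow>[(u, s a * v). (u, v) \<leftarrow> Dl k]. \<alpha> (S x) * \<alpha> y)"
      using coring.comult_ract[OF left_coring, of k a] unfolding left_ract_def
      by (rule sum_left_eq[unfolded left_ract_def])
        (simp_all add: biadditive_def S_add a.add antipode_base_brt a.mult distrib_left
          distrib_right ac_simps)
    also have "\<dots> = a * (\<Sum>(x, y)\<leftarrow>Dl k. \<alpha> (S x) * \<alpha> y)"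
      by (simp add: o_def case_prod_unfold a.source_mult sum_list_const_mult mult.left_commute)
    finally show ?thesis
      by (simp add: antipode_left_brt mult.assoc)
  qed
  then show ?thesis
    using right_bialgebroid.counit_mult_source[OF right, of h k] by simp
qed

text \<open>
  The mirror image of \<open>er_mult_brt\<close>, with a factor \<open>t(a)\<close> between \<open>x\<close> and \<open>S(y)\<close>.
\<close>

lemma el_mult_brt: "\<alpha> (t (el (h * k))) = \<alpha> (t (el h)) * \<alpha> (t (el k))"
proof -
  have "\<alpha> (t (el (h * t a))) = \<alpha> (t (el h)) * \<alpha> (t a)" for a
  proof -
    have "(\<Sum>(x, y)\<leftarrow>Dr (h * t a). \<alpha> x * \<alpha> (S y)) =
        (\<Sum>(x, y)\<leftarrow>[(u * t a, v). (u, v) \<leftarrow> Dr h]. \<alpha> x * \<alpha> (S y))"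
      using coring.comult_lact[OF right_coring, of a h] unfolding right_lact_def
      by (rule sum_right_eq[unfolded right_lact_def])
        (simp_all add: biadditive_def S_add a.add antipode_base_brt a.source_mult distrib_left
          distrib_right ac_simps)
    also have "\<dots> = \<alpha> (t a) * (\<Sum>(x, y)\<leftarrow>Dr h. \<alpha> x * \<alpha> (S y))"
      by (simp add: o_def case_prod_unfold a.mult sum_list_const_mult ac_simps flip: sum_list_const_mult)
    finally show ?thesis
      by (simp add: antipode_right_brt mult.commute)
  qed
  then show ?thesis
    using left_bialgebroid.counit_mult_source[OF left, of h k] by simp
qed

lemma er_antipode_brt: "(\<Sum>(x, y)\<leftarrow>Dr h. er x * \<alpha> (S y)) = \<alpha> (S h)"
proof -
  have "\<alpha> (S (\<Sum>(x, y)\<leftarrow>Dr h. y * t (er x))) = (\<Sum>(x, y)\<leftarrow>Dr h. \<alpha> (S (y * t (er x))))"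
    by (rule sum_list_additive[where g = "\<lambda>h. \<alpha> (S h)"]) (simp add: S_add a.add)
  then show ?thesis
    by (simp add: right_counit antipode_base_brt)
qed

lemma antipode_el_brt: "(\<Sum>(x, y)\<leftarrow>Dl h. \<alpha> (S x) * \<alpha> (t (el y))) = \<alpha> (S h)"
proof -
  have "\<alpha> (S (\<Sum>(x, y)\<leftarrow>Dl h. s (el y) * x)) = (\<Sum>(x, y)\<leftarrow>Dl h. \<alpha> (S (s (el y) * x)))"
    by (rule sum_list_additive[where g = "\<lambda>h. \<alpha> (S h)"]) (simp add: S_add a.add)
  then show ?thesis
    by (simp add: left_counit antipode_base_brt mult.commute)
qed

text \<open>
  Expanding \<open>\<alpha>(t(\<epsilon>\<^sub>l(y)))\<close> as \<open>\<alpha>(y\<^sup>(\<^sup>1\<^sup>)) \<alpha>(S(y\<^sup>(\<^sup>2\<^sup>)))\<close> and rebracketing by mixed coassociativity. This is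
  the step \<open>g *\<^sub>l (\<alpha> *\<^sub>r \<alpha>S) = (g *\<^sub>l \<alpha>) *\<^sub>r \<alpha>S\<close> of the uniqueness of inverses.
\<close>

lemma antipode_fold_brt:
  fixes G :: "'h \<Rightarrow> 'a"
  assumes G: "\<And>x y. G (x + y) = G x + G y" "\<And>a x. G (s a * x) = \<alpha> (t a) * G x"
  shows "(\<Sum>(x, y)\<leftarrow>Dl h. G x * \<alpha> (t (el y))) =
    (\<Sum>(x, y)\<leftarrow>Dr h. (\<Sum>(x1, x2)\<leftarrow>Dl x. G x1 * \<alpha> x2) * \<alpha> (S y))"
proof -
  have "(\<Sum>(x, y)\<leftarrow>Dl h. G x * \<alpha> (t (el y))) =
      (\<Sum>(x, y, z)\<leftarrow>map_right Dr (Dl h). G x * \<alpha> y * \<alpha> (S z))"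
    unfolding sum_list_map_right
    by (simp add: case_prod_unfold sum_list_const_mult mult.assoc flip: antipode_right_brt)
  also have "\<dots> = (\<Sum>(x, y, z)\<leftarrow>map_left Dl (Dr h). G x * \<alpha> y * \<alpha> (S z))"
    by (rule tensor3_eq_sum_list[OF coassoc_left_right, symmetric])
      (simp_all add: left_ract_def left_lact_def right_ract_def right_lact_def G a.add S_add
        a.mult a.source antipode_base_brt a.source_mult distrib_left distrib_right ac_simps)
  also have "\<dots> = (\<Sum>(x, y)\<leftarrow>Dr h. (\<Sum>(x1, x2)\<leftarrow>Dl x. G x1 * \<alpha> x2) * \<alpha> (S y))"
    unfolding sum_list_map_left
    by (simp add: case_prod_unfold sum_list_mult_const)
  finally show ?thesis .
qed

text \<open>
  As functions on \<open>H \<otimes> H\<close>, \<open>\<alpha>(S(hk))\<close> acts as a left inverse of \<open>\<alpha>(hk)\<close> for \<open>*\<^sub>l\<close> and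
  \<open>\<alpha>(S(h)) \<alpha>(S(k))\<close> as a right inverse for \<open>*\<^sub>r\<close>, hence they are equal. As Sweedler sums over \<open>h\<close> and \<open>k\<close>,
  both are equal to the sum of \<open>\<alpha>(S(h\<^sub>(\<^sub>1\<^sub>) k\<^sub>(\<^sub>1\<^sub>))) \<alpha>(t(\<epsilon>\<^sub>l(h\<^sub>(\<^sub>2\<^sub>)))) \<alpha>(t(\<epsilon>\<^sub>l(k\<^sub>(\<^sub>2\<^sub>))))\<close>: the first by the counit
  law for \<open>hk\<close>, the second by folding first over \<open>h\<close> and then over \<open>k\<close>. The function \<open>G\<close> below is
  the sum over \<open>h\<close> alone. For fixed summands of \<open>h\<close> it would not be balanced in \<open>k\<close>; that \<open>\<Delta>\<^sub>l(h)\<close> lies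
  in the Takeuchi product repairs this.
\<close>

lemma antipode_mult_brt: "\<alpha> (S (h * k)) = \<alpha> (S h) * \<alpha> (S k)"
proof -
  define G where "G z = (\<Sum>(x, y)\<leftarrow>Dl h. \<alpha> (S (x * z)) * \<alpha> (t (el y)))" for z
  have G_add: "G (z + z') = G z + G z'" for z z'
    unfolding G_def
    by (simp add: distrib_left S_add a.add distrib_right sum_list_addf case_prod_unfold)
  have G_s: "G (s a * z) = \<alpha> (t a) * G z" for a z
  proof -
    have "G (s a * z) = (\<Sum>(x, y)\<leftarrow>[(x * s a, y). (x, y) \<leftarrow> Dl h]. \<alpha> (S (x * z)) * \<alpha> (t (el y)))"
      unfolding G_def by (simp add: o_def case_prod_unfold mult.assoc)
    also have "\<dots> = (\<Sum>(x, y)\<leftarrow>[(x, y * t a). (x, y) \<leftarrow> Dl h]. \<alpha> (S (x * z)) * \<alpha> (t (el y)))"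
      using left_bialgebroid.comult_takeuchi[OF left, of a h]
      by (rule sum_left_eq)
        (simp_all add: biadditive_def S_add a.add t_add counits_additive antipode_base_brt mult.assoc
          el_base t_mult a.mult distrib_left distrib_right mult.left_commute)
    also have "\<dots> = \<alpha> (t a) * G z"
    proof -
      have "\<alpha> (t (el (t a))) = \<alpha> (t a)"
        using el_base(1)[of a 1] by (simp add: t_mult t_el_one)
      then show ?thesis
        unfolding G_def
        by (simp add: o_def case_prod_unfold el_mult_brt ac_simps flip: sum_list_const_mult)
    qed
    finally show ?thesis .
  qed
  have inner: "(\<Sum>(x', y')\<leftarrow>Dl z. G x' * \<alpha> y') = er z * \<alpha> (S h)" for z
  proof -
    have bal: "biadditive (\<lambda>x y. \<alpha> (S x) * \<alpha> y)"
      "\<And>x a y. \<alpha> (S (s a * x)) * \<alpha> y = \<alpha> (S x) * \<alpha> (t a * y)"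
      by (simp_all add: biadditive_def S_add a.add antipode_base_brt a.mult distrib_left
          distrib_right ac_simps)
    \<comment> \<open>Folding over \<open>h\<close> inside \<open>G\<close> turns the two left coproducts into that of a product, to which
      the antipode axiom applies.\<close>
    have "(\<Sum>(x', y')\<leftarrow>Dl z. G x' * \<alpha> y') =
        (\<Sum>(x', y')\<leftarrow>Dl z. \<Sum>(x, y)\<leftarrow>Dr h. \<Sum>(u, v)\<leftarrow>Dl x. \<alpha> (S (u * x')) * \<alpha> (v * y') * \<alpha> (S y))"
    proof (rule sum_list_pair_cong)
      fix x' y'
      have "G x' = (\<Sum>(x, y)\<leftarrow>Dr h. (\<Sum>(u, v)\<leftarrow>Dl x. \<alpha> (S (u * x')) * \<alpha> v) * \<alpha> (S y))"
        unfolding G_def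
        by (rule antipode_fold_brt)
          (simp_all add: distrib_right S_add a.add mult.assoc antipode_base_brt)
      then show "G x' * \<alpha> y' =
          (\<Sum>(x, y)\<leftarrow>Dr h. \<Sum>(u, v)\<leftarrow>Dl x. \<alpha> (S (u * x')) * \<alpha> (v * y') * \<alpha> (S y))"
        by (simp add: case_prod_unfold a.mult ac_simps flip: sum_list_const_mult)
    qed
    also have "\<dots> = (\<Sum>(x, y)\<leftarrow>Dr h.
        (\<Sum>(u, v)\<leftarrow>Dl x. \<Sum>(x', y')\<leftarrow>Dl z. \<alpha> (S (u * x')) * \<alpha> (v * y')) * \<alpha> (S y))"
      by (subst sum_list_pair_swap, subst sum_list_pair_swap)
        (simp add: case_prod_unfold flip: sum_list_mult_const)
    also have "\<dots> = (\<Sum>(x, y)\<leftarrow>Dr h. er (x * z) * \<alpha> 1 * \<alpha> (S y))"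
      by (simp only: sum_left_eq[OF left_bialgebroid.comult_mult[OF left] bal]
          sum_list_tensor_mult antipode_left_brt[symmetric])
    also have "\<dots> = (\<Sum>(x, y)\<leftarrow>Dr h. er z * (er x * \<alpha> (S y)))"
      by (rule sum_list_pair_cong) (subst er_mult_brt, simp add: mult.assoc mult.left_commute)
    also have "\<dots> = er z * (\<Sum>(x, y)\<leftarrow>Dr h. er x * \<alpha> (S y))"
      by (simp add: case_prod_unfold sum_list_const_mult)
    finally show ?thesis
      by (simp add: er_antipode_brt)
  qed
  have "\<alpha> (S (h * k)) = (\<Sum>(x, y)\<leftarrow>Dl (h * k). \<alpha> (S x) * \<alpha> (t (el y)))"
    by (simp add: antipode_el_brt)
  also have "\<dots> = (\<Sum>(x, y)\<leftarrow>tensor_mult (*) (Dl h) (Dl k). \<alpha> (S x) * \<alpha> (t (el y)))"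
    using left_bialgebroid.comult_mult[OF left]
    by (rule sum_left_eq)
      (simp_all add: biadditive_def S_add a.add t_add counits_additive antipode_base_brt
        el_base t_mult a.mult distrib_left distrib_right ac_simps)
  also have "\<dots> = (\<Sum>(x', y')\<leftarrow>Dl k. G x' * \<alpha> (t (el y')))"
    unfolding sum_list_tensor_mult G_def
    by (subst sum_list_pair_swap)
      (simp add: case_prod_unfold el_mult_brt mult.assoc flip: sum_list_mult_const)
  also have "\<dots> = (\<Sum>(x, y)\<leftarrow>Dr k. er x * \<alpha> (S h) * \<alpha> (S y))"
    by (simp add: antipode_fold_brt G_add G_s inner)
  also have "\<dots> = \<alpha> (S h) * (\<Sum>(x, y)\<leftarrow>Dr k. er x * \<alpha> (S y))"
    by (simp add: case_prod_unfold ac_simps flip: sum_list_const_mult)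
  finally show ?thesis
    by (simp add: er_antipode_brt)
qed


section \<open>Inverses of local biretractions\<close>

definition star where "star h = \<psi> (\<alpha> (S h))"

lemma star_t: "star (t a) = \<psi> a"
  unfolding star_def by (simp add: S_images a.source a.\<psi>_mult_one)

text \<open>
  The roles of \<open>\<alpha> \<circ> t\<close> and its inverse are exchanged: \<open>S(t(a)) = s(a)\<close> makes
  \<open>\<alpha>\<^sup>\<star> \<circ> t\<close> equal to \<open>\<psi>\<close>.
\<close>

lemma star_brt: "brt star (\<alpha> 1) (\<lambda>a. \<alpha> (t a))"
proof
  show "star (x + y) = star x + star y" for x y
    unfolding star_def by (simp add: S_add a.add a.\<psi>_add)
  show "star (x * y) = star x * star y" for x y
    unfolding star_def by (simp add: antipode_mult_brt a.\<psi>_mult)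
  show "star (s a) = a * star 1" for a
    unfolding star_def by (simp add: S_images S_one a.\<psi>_target a.\<psi>_one)
  show "star (t (\<alpha> 1)) = star 1"
    by (simp add: star_t) (simp add: star_def S_one)
  show "star (t (\<alpha> (t a))) = a * star 1" for a
    by (simp add: star_t a.\<psi>_target) (simp add: star_def S_one a.\<psi>_one)
  show "\<alpha> (t (star (t a))) = a * \<alpha> 1" for a
    by (simp add: star_t a.target_\<psi>)
qed simp

lemma conv_right_star: "dr.conv \<alpha> star = unit e"
proof
  fix h
  have "dr.conv \<alpha> star h = \<psi> (\<Sum>(x, y)\<leftarrow>Dr h. \<alpha> x * \<alpha> (S y))"
    unfolding convolution_def star_t
    by (simp add: star_def sum_list_additive[where g = \<psi>, OF a.\<psi>_add] a.\<psi>_mult)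
  then show "dr.conv \<alpha> star h = unit e h"
    by (simp add: antipode_right_brt a.\<psi>_target unit_def)
qed

lemma conv_left_star: "dl.conv star \<alpha> = (\<lambda>h. er h * \<alpha> 1)"
  unfolding convolution_def star_def
  by (simp add: a.target_\<psi> antipode_left_brt)

text \<open>
  \<open>\<epsilon>\<^sub>l e\<close> is \<open>\<psi> \<circ> \<alpha> \<circ> t \<circ> \<epsilon>\<^sub>l\<close>, so it is multiplicative by \<open>el_mult_brt\<close>.
\<close>

lemma unit_brt: "brt (unit e) e (\<lambda>a. a * e)"
proof -
  have unit: "unit e h = \<psi> (\<alpha> (t (el h)))" for h
    by (simp add: unit_def a.\<psi>_target)
  have one: "unit e 1 = e"
    by (simp add: unit t_el_one a.\<psi>_one)
  have base: "unit e (s a) = a * e" "unit e (t a) = a * e" for a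
    using el_base[of a 1] one by (simp_all add: unit_def mult.assoc)
  show ?thesis
  proof
    show "unit e (x + y) = unit e x + unit e y" for x y
      by (simp add: unit_def counits_additive distrib_right)
    show "unit e (x * y) = unit e x * unit e y" for x y
      by (simp add: unit el_mult_brt a.\<psi>_mult)
  qed (simp_all add: one base mult.assoc)
qed

lemma unit_conv_left: "dl.conv (unit q) \<alpha> h = \<alpha> (t q) * \<alpha> h"
proof -
  have "dl.conv (unit q) \<alpha> h = \<alpha> (t q) * (\<Sum>(x, y)\<leftarrow>Dl h. \<alpha> (t (el x) * y))"
    unfolding convolution_def unit_def
    by (simp add: case_prod_unfold t_mult a.mult ac_simps flip: sum_list_const_mult)
  also have "(\<Sum>(x, y)\<leftarrow>Dl h. \<alpha> (t (el x) * y)) = \<alpha> h"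
    using sum_list_additive[where g = \<alpha>, OF a.add, of "\<lambda>x y. t (el x) * y" "Dl h"]
    by (simp add: left_counit)
  finally show ?thesis .
qed

lemma unit_conv_left_domain: "dl.conv (unit e) \<alpha> = \<alpha>"
  by (simp add: fun_eq_iff unit_conv_left a.target_idem)

end

text \<open>
  The range idempotent \<open>\<alpha>(1)\<close> is the domain idempotent of \<open>\<alpha>\<^sup>\<star>\<close>.
\<close>

lemma unit_brt_range:
  assumes "brt \<alpha> e \<psi>"
  shows "brt (unit (\<alpha> 1)) (\<alpha> 1) (\<lambda>a. a * \<alpha> 1)"
  using unit_brt[OF star_brt[OF assms]] .

lemma unit_conv_right_range:
  assumes "brt \<alpha> e \<psi>"
  shows "dl.conv \<alpha> (unit (\<alpha> 1)) = \<alpha>"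
proof
  fix h
  interpret a: local_biretraction s t \<alpha> e \<psi> by fact
  interpret u: local_biretraction s t "unit (\<alpha> 1)" "\<alpha> 1" "\<lambda>a. a * \<alpha> 1"
    by (rule unit_brt_range[OF assms])
  have one: "unit (\<alpha> 1) 1 = \<alpha> 1"
    using a.source[of "el 1"] by (simp add: unit_def s_el_one)
  have "unit (\<alpha> 1) (t b) = b * \<alpha> 1" for b
    using el_base(1)[of b 1] one by (simp add: unit_def mult.assoc)
  then have "unit (\<alpha> 1) (t (\<alpha> x)) * unit (\<alpha> 1) y = \<alpha> (s (el y) * x)" for x y
    by (simp add: a.source_mult) (simp add: unit_def mult.left_commute[of "\<alpha> x"])
  then have "dl.conv \<alpha> (unit (\<alpha> 1)) h = (\<Sum>(x, y)\<leftarrow>Dl h. \<alpha> (s (el y) * x))"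
    unfolding convolution_def by simp
  also have "\<dots> = \<alpha> h"
    using sum_list_additive[where g = \<alpha>, OF a.add, of "\<lambda>x y. s (el y) * x" "Dl h"]
    by (simp add: left_counit)
  finally show "dl.conv \<alpha> (unit (\<alpha> 1)) h = \<alpha> h" .
qed

lemma unit_conv_unit:
  assumes "brt (unit r) f \<chi>"
  shows "dl.conv (unit q) (unit r) = unit (q * r)"
proof
  fix h
  interpret u: local_biretraction s t "unit r" f \<chi> by fact
  have "unit r (t q) = q * unit r 1"
    using el_base(1)[of q 1] by (simp add: unit_def mult.assoc)
  then have "dl.conv (unit q) (unit r) h = q * unit r h"
    by (simp add: unit_conv_left[OF assms] mult.assoc)
  then show "dl.conv (unit q) (unit r) h = unit (q * r) h"
    by (simp add: unit_def mult.left_commute)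
qed

text \<open>
  \<open>\<epsilon>\<^sub>r \<alpha>(1)\<close> plays for \<open>*\<^sub>r\<close> the role that \<open>\<epsilon>\<^sub>l \<alpha>(1)\<close> plays for \<open>*\<^sub>l\<close>.
\<close>

lemma unit_conv_counit:
  assumes "brt \<alpha> e \<psi>"
  shows "dr.conv (unit (\<alpha> 1)) (\<lambda>h. er h * \<alpha> 1) = unit (\<alpha> 1)"
proof
  fix h
  interpret a: local_biretraction s t \<alpha> e \<psi> by fact
  interpret u: local_biretraction s t "unit (\<alpha> 1)" "\<alpha> 1" "\<lambda>a. a * \<alpha> 1"
    by (rule unit_brt_range[OF assms])
  have "er 1 * \<alpha> 1 = \<alpha> 1"
    using a.source[of "er 1"] by (simp add: s_er_one)
  then have "er (t b) * \<alpha> 1 = b * \<alpha> 1" for b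
    using er_base(1)[of 1 b] by (simp add: mult.assoc)
  moreover have "unit (\<alpha> 1) x * \<alpha> 1 = unit (\<alpha> 1) x" for x
    by (simp add: unit_def mult.assoc)
  ultimately have "er (t (unit (\<alpha> 1) x)) * \<alpha> 1 * (er y * \<alpha> 1) = unit (\<alpha> 1) (x * s (er y))"
    for x y
    by (simp add: u.source_mult mult.left_commute[of "unit (\<alpha> 1) x"])
  then have "dr.conv (unit (\<alpha> 1)) (\<lambda>h. er h * \<alpha> 1) h =
      (\<Sum>(x, y)\<leftarrow>Dr h. unit (\<alpha> 1) (x * s (er y)))"
    unfolding convolution_def by simp
  also have "\<dots> = unit (\<alpha> 1) h"
    using sum_list_additive[where g = "unit (\<alpha> 1)", OF u.add, of "\<lambda>x y. x * s (er y)" "Dr h"]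
    by (simp add: right_counit)
  finally show "dr.conv (unit (\<alpha> 1)) (\<lambda>h. er h * \<alpha> 1) h = unit (\<alpha> 1) h" .
qed

lemma conv_assoc:
  assumes "brt \<alpha> e \<psi>" "brt \<beta> f \<chi>" "brt \<gamma> g \<omega>"
  shows "dl.conv (dl.conv \<alpha> \<beta>) \<gamma> = dl.conv \<alpha> (dl.conv \<beta> \<gamma>)"
    and "dr.conv (dl.conv \<alpha> \<beta>) \<gamma> = dl.conv \<alpha> (dr.conv \<beta> \<gamma>)"
    and "dl.conv (dr.conv \<alpha> \<beta>) \<gamma> = dr.conv \<alpha> (dl.conv \<beta> \<gamma>)"
proof -
  show "dl.conv (dl.conv \<alpha> \<beta>) \<gamma> = dl.conv \<alpha> (dl.conv \<beta> \<gamma>)"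
    by (rule ext, rule convolution_assoc[OF dl.algebra_comult_axioms dl.algebra_comult_axioms _ assms])
      (rule coassoc_left_left_bibalanced)
  show "dr.conv (dl.conv \<alpha> \<beta>) \<gamma> = dl.conv \<alpha> (dr.conv \<beta> \<gamma>)"
    by (rule ext, rule convolution_assoc[OF dl.algebra_comult_axioms dr.algebra_comult_axioms _ assms])
      (rule coassoc_left_right_bibalanced)
  show "dl.conv (dr.conv \<alpha> \<beta>) \<gamma> = dr.conv \<alpha> (dl.conv \<beta> \<gamma>)"
    by (rule ext, rule convolution_assoc[OF dr.algebra_comult_axioms dl.algebra_comult_axioms _ assms])
      (rule coassoc_right_left_bibalanced)
qed

text \<open>
  The factor \<open>\<epsilon>\<^sub>l \<alpha>(1)\<close> on the left of \<open>\<alpha>\<^sup>\<star>\<close> turns the mixed relations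
  \<open>conv_right_star\<close> and \<open>conv_left_star\<close> into relations for \<open>*\<^sub>l\<close> alone.
\<close>

lemma brt_inverse:
  assumes \<alpha>: "brt \<alpha> e \<psi>"
  obtains \<beta> f \<chi> where "brt \<beta> f \<chi>" "dl.conv \<alpha> \<beta> = unit e" "dl.conv \<beta> \<alpha> = unit (\<alpha> 1)"
    "dl.conv (unit (\<alpha> 1)) \<beta> = \<beta>"
proof
  let ?u = "unit (\<alpha> 1)" and ?star = "star \<alpha> \<psi>"
  note u = unit_brt_range[OF \<alpha>] and star = star_brt[OF \<alpha>]
  show "brt (dr.conv ?u ?star) (\<alpha> 1 * \<alpha> 1) ((\<lambda>a. a * \<alpha> 1) \<circ> (\<lambda>a. \<alpha> (t a)))"
    by (rule dr.convolution_brt[OF u star])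
  have "dl.conv \<alpha> (dr.conv ?u ?star) = dr.conv (dl.conv \<alpha> ?u) ?star"
    using conv_assoc(2)[OF \<alpha> u star] by auto
  then show "dl.conv \<alpha> (dr.conv ?u ?star) = unit e"
    by (simp add: unit_conv_right_range[OF \<alpha>] conv_right_star[OF \<alpha>])
  have "dl.conv (dr.conv ?u ?star) \<alpha> = dr.conv ?u (dl.conv ?star \<alpha>)"
    using conv_assoc(3)[OF u star \<alpha>] by auto
  then show "dl.conv (dr.conv ?u ?star) \<alpha> = ?u"
    by (simp add: unit_conv_counit[OF \<alpha>] conv_left_star[OF \<alpha>])
  have "dl.conv ?u (dr.conv ?u ?star) = dr.conv (dl.conv ?u ?u) ?star"
    using conv_assoc(2)[OF u u star] by auto
  then show "dl.conv ?u (dr.conv ?u ?star) = dr.conv ?u ?star"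
    by (simp add: unit_conv_left_domain[OF u])
qed

theorem Brt_inverse_semigroup:
  "\<exists>inv. inverse_semigroup_on (Brt scaleA scaleH s t) dl.conv inv"
proof -
  let ?X = "Brt scaleA scaleH s t"
  have "\<forall>\<alpha>\<in>?X. \<exists>\<beta>\<in>?X. \<exists>q r. unit q \<in> ?X \<and> unit r \<in> ?X \<and> dl.conv \<alpha> \<beta> = unit q \<and>
      dl.conv \<beta> \<alpha> = unit r \<and> dl.conv (unit q) \<alpha> = \<alpha> \<and> dl.conv (unit r) \<beta> = \<beta>"
  proof
    fix \<alpha> assume "\<alpha> \<in> ?X"
    then obtain e \<psi> where \<alpha>: "brt \<alpha> e \<psi>"
      by (auto simp: Brt_iff)
    from brt_inverse[OF \<alpha>] obtain \<beta> f \<chi> where \<beta>: "brt \<beta> f \<chi>" "dl.conv \<alpha> \<beta> = unit e"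
      "dl.conv \<beta> \<alpha> = unit (\<alpha> 1)" "dl.conv (unit (\<alpha> 1)) \<beta> = \<beta>" .
    have "\<beta> \<in> ?X" "unit e \<in> ?X" "unit (\<alpha> 1) \<in> ?X"
      using \<beta>(1) unit_brt[OF \<alpha>] unit_brt_range[OF \<alpha>] unfolding Brt_iff by blast+
    then show "\<exists>\<beta>\<in>?X. \<exists>q r. unit q \<in> ?X \<and> unit r \<in> ?X \<and> dl.conv \<alpha> \<beta> = unit q \<and>
        dl.conv \<beta> \<alpha> = unit r \<and> dl.conv (unit q) \<alpha> = \<alpha> \<and> dl.conv (unit r) \<beta> = \<beta>"
      using \<beta> unit_conv_left_domain[OF \<alpha>] by blast
  qed
  then obtain inv where inv: "\<And>\<alpha>. \<alpha> \<in> ?X \<Longrightarrow> inv \<alpha> \<in> ?X"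
    "\<And>\<alpha>. \<alpha> \<in> ?X \<Longrightarrow> \<exists>q r. unit q \<in> ?X \<and> unit r \<in> ?X \<and> dl.conv \<alpha> (inv \<alpha>) = unit q \<and>
      dl.conv (inv \<alpha>) \<alpha> = unit r \<and> dl.conv (unit q) \<alpha> = \<alpha> \<and> dl.conv (unit r) (inv \<alpha>) = inv \<alpha>"
    by metis
  have "inverse_semigroup_on ?X dl.conv inv"
  proof
    fix \<alpha> \<beta> \<gamma>
    assume \<alpha>: "\<alpha> \<in> ?X" and \<beta>: "\<beta> \<in> ?X" and \<gamma>: "\<gamma> \<in> ?X"
    from \<alpha> \<beta> \<gamma> show "dl.conv (dl.conv \<alpha> \<beta>) \<gamma> = dl.conv \<alpha> (dl.conv \<beta> \<gamma>)"
      unfolding Brt_iff using conv_assoc(1) by blast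
  next
    fix \<alpha> \<beta>
    assume \<alpha>: "\<alpha> \<in> ?X" and \<beta>: "\<beta> \<in> ?X"
    from \<alpha> \<beta> show "dl.conv \<alpha> \<beta> \<in> ?X"
      unfolding Brt_iff using dl.convolution_brt by blast
    obtain q where q: "unit q \<in> ?X" "dl.conv \<alpha> (inv \<alpha>) = unit q"
      using inv(2)[OF \<alpha>] by blast
    obtain r where r: "unit r \<in> ?X" "dl.conv (inv \<beta>) \<beta> = unit r"
      using inv(2)[OF \<beta>] by blast
    have "dl.conv (unit q) (unit r) = unit (q * r)" "dl.conv (unit r) (unit q) = unit (r * q)"
      using q r unit_conv_unit unfolding Brt_iff by blast+
    then show "dl.conv (dl.conv \<alpha> (inv \<alpha>)) (dl.conv (inv \<beta>) \<beta>) =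
        dl.conv (dl.conv (inv \<beta>) \<beta>) (dl.conv \<alpha> (inv \<alpha>))"
      by (simp add: q r mult.commute)
  next
    fix \<alpha> assume \<alpha>: "\<alpha> \<in> ?X"
    from \<alpha> show "inv \<alpha> \<in> ?X" by (rule inv)
    show "dl.conv (dl.conv \<alpha> (inv \<alpha>)) \<alpha> = \<alpha>"
      "dl.conv (dl.conv (inv \<alpha>) \<alpha>) (inv \<alpha>) = inv \<alpha>"
      using inv(2)[OF \<alpha>] by auto
  qed
  then show ?thesis by blast
qed

end

theorem theorem4p25:
  fixes scaleA :: "'k::field_char_0 \<Rightarrow> 'a::{comm_ring, comm_monoid_mult} \<Rightarrow> 'a"
    and scaleH :: "'k \<Rightarrow> 'h::{ring, monoid_mult} \<Rightarrow> 'h"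
    and sl tl sr tr s t :: "'a \<Rightarrow> 'h"
    and Dl Dr :: "'h \<Rightarrow> ('h \<times> 'h) list"
    and el er :: "'h \<Rightarrow> 'a"
    and S :: "'h \<Rightarrow> 'h"
  assumes hopf: "hopf_algebroid scaleA scaleH sl tl Dl el sr tr Dr er S"
    and "sl = t" and "tr = t" and "sr = s" and "tl = s"
  shows "\<exists>(D :: (('h \<Rightarrow> 'a) \<Rightarrow>\<^sub>0 'k) \<Rightarrow> ((('h \<Rightarrow> 'a) \<Rightarrow>\<^sub>0 'k) \<times> (('h \<Rightarrow> 'a) \<Rightarrow>\<^sub>0 'k)) list) \<S>.
      quantum_inverse_semigroup free_scale (free_space (Brt scaleA scaleH s t))
        (free_mult (convolution t Dl)) D \<S> \<and>
      (\<forall>\<alpha>\<in>Brt scaleA scaleH s t.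
        tensor_eq_over free_scale (free_space (Brt scaleA scaleH s t))
          (D (Poly_Mapping.single \<alpha> 1)) [(Poly_Mapping.single \<alpha> 1, Poly_Mapping.single \<alpha> 1)])"
proof -
  interpret biretractable_hopf_algebroid scaleA scaleH s t Dl el Dr er S
    using assms by (simp add: biretractable_hopf_algebroid_def)
  obtain inv where "inverse_semigroup_on (Brt scaleA scaleH s t) (convolution t Dl) inv"
    using Brt_inverse_semigroup by blast
  then have "quantum_inverse_semigroup free_scale (free_space (Brt scaleA scaleH s t))
      (free_mult (convolution t Dl)) grouplike_comult
      (free_map inv :: (('h \<Rightarrow> 'a) \<Rightarrow>\<^sub>0 'k) \<Rightarrow> _)"
    by (rule inverse_semigroup_on.free_space_quantum_inverse_semigroup)
  moreover have "tensor_eq_over free_scale (free_space (Brt scaleA scaleH s t))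
      (grouplike_comult (Poly_Mapping.single \<alpha> (1 :: 'k)))
      [(Poly_Mapping.single \<alpha> 1, Poly_Mapping.single \<alpha> 1)]"
    if "\<alpha> \<in> Brt scaleA scaleH s t" for \<alpha>
    using that unfolding tensor_eq_def
    by (auto simp: grouplike_comult_single intro!: fsum_eq.refl single_in_free_space)
  ultimately show ?thesis
    by blast
qed

end
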